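(* Let $\Gamma$ be a discrete abelian group, $A, B\subseteq \Gamma$ nonempty, and let $K\le\Gamma$ be a finite index subgroup such that $K$ is the stabilizer of $A+B+K$ and such that for every extreme invariant mean $\nu$ on $\ell^\infty(\Gamma)$ with $\nu(A+B)<\nu(A)+\nu(B)$ one has $\nu(A+B)=\nu(A+B+K)$ and $\nu(A+B+K)=\nu(A+K)+\nu(B+K)-\nu(K)$. Let $\mathbf \Phi=(\Phi_{i})_{i\in I}$ be a Følner net satisfying \[\delta:=\underline{\mathrm{d}}_{\mathbf \Phi}(A)+\underline{\mathrm{d}}_{\mathbf \Phi}(B)-\underline{\mathrm{d}}_{\mathbf \Phi}(A+B)>0.\] Then there is a subnet $(\Phi_{i(j)})_{j\in J}$ and a Følner net $\mathbf \Psi=(\Psi_j)_{j\in J}$ such that $\Psi_{j}\subseteq \Phi_{i(j)}$ for all $j\in J$, and \begin{enumerate} \item $\liminf_{j\in J} |\Psi_{j}|/|\Phi_{i(j)}|\geq [\Gamma:K]\delta$; \item $\mathrm{d}_{\mathbf \Psi}(A+B)=\mathrm{d}_{\mathbf \Psi}(A+B+K)$; \item $\mathrm{d}_{\mathbf \Psi}(A)+\mathrm{d}_{\mathbf \Psi}(B) - \mathrm{d}_{\mathbf \Psi}(A+B)\geq \delta$. \end{enumerate} Moreover, if $\mathbf\Phi=(\Phi_n)_{n\in\mathbb N}$ is a Følner sequence satisfying the same hypothesis, then there is a subsequence $(\Phi_{n_j})_{j\in\mathbb N}$ and a Følner sequence $\mathbf\Psi=(\Psi_j)_{j\in\mathbb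 N}$ with $\Psi_j\subseteq\Phi_{n_j}$ for all $j$, satisfying (1)–(3) with $\Phi_{n_j}$ in place of $\Phi_{i(j)}$ and $j\to\infty$ in place of $j\in J$.
   Context: Means: linear functionals $m$ on $\ell^\infty(\Gamma)$ with $m(1_\Gamma)=1$, $m(f)\ge0$ for $f:\Gamma\to[0,1]$; $m(C):=m(1_C)$; invariant if $m(\tau_\gamma f)=m(f)$, $(\tau_\gamma f)(x)=f(x-\gamma)$; extreme invariant means are extreme points of the convex weak$^*$-compact set of invariant means. Stabilizer of $C$: $\{\gamma:C+\gamma=C\}$. A directed set $(I,\preceq)$ is a set with a transitive relation in which any two elements have a common upper bound; a net is a function on a directed set. A subnet of $(y_i)_{i\in I}$ is $(y_{i(j)})_{j\in J}$ where $(J,\preceq')$ is directed, $j_1\preceq' j_2\Rightarrow i(j_1)\preceq i(j_2)$, and for every $i_0\in I$ there is $j\in J$ with $i_0\preceq i(j)$. A Følner net is a net $(\Phi_i)_{i\in I}$ of finite nonempty subsets of $\Gamma$ with $\lim_{i\in I}|\Phi_i\triangle(\Phi_i+t)|/|\Phi_i|=0$ for all $t\in\Gamma$; a Følner sequence is the case $I=\mathbb N$ (only possible for countable $\Gamma$). For $C\subseteq\Gamma$: $\underline{\mathrm d}_{\mathbf\Phi}(C):=\lim_{i\in I}\inf_{j\succeq i}|C\cap\Phi_j|/|\Phi_j|$, $\bar{\mathrm d}_{\mathbf\Phi}(C):=\lim_{i\in I}\sup_{j\succeq i}|C\cap\Phi_j|/|\Phi_j|$, and $\mathrm d_{\mathbf\Phi}(C)$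 denotes the common value when these are equal. $\liminf_{j\in J}x_j:=\lim_{j\in J}\inf_{j'\succeq j}x_{j'}$. *)

theory Defs
  imports "HOL-Analysis.Analysis" "HOL-Library.Set_Algebras"
begin

section \<open>Subgroups and stabilizers\<close>

definition is_subgroup :: "'a::ab_group_add set \<Rightarrow> bool" where
  "is_subgroup K \<longleftrightarrow> 0 \<in> K \<and> (\<forall>x\<in>K. \<forall>y\<in>K. x + y \<in> K) \<and> (\<forall>x\<in>K. - x \<in> K)"

definition cosets :: "'a::ab_group_add set \<Rightarrow> 'a set set" where
  "cosets K = range (\<lambda>g. g +o K)"

text \<open>As \<^const>\<open>card\<close> is 0 on infinite sets, \<open>group_index\<close> is meaningful only together with
  \<open>finite_index\<close>.\<close>

definition finite_index :: "'a::ab_group_add set \<Rightarrow> bool" where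
  "finite_index K \<longleftrightarrow> finite (cosets K)"

definition group_index :: "'a::ab_group_add set \<Rightarrow> nat" where
  "group_index K = card (cosets K)"

definition stabilizer :: "'a::ab_group_add set \<Rightarrow> 'a set" where
  "stabilizer C = {g. (\<lambda>x. x + g) ` C = C}"


section \<open>Invariant means\<close>

text \<open>A discrete abelian group is a type of class \<^class>\<open>ab_group_add\<close> and
  \<^class>\<open>discrete_topology\<close>. Every function on it is continuous, so the library's Banach space
  of bounded continuous real functions on it is the space of all bounded real functions.\<close>

definition linf_indicator :: "'a::discrete_topology set \<Rightarrow> ('a \<Rightarrow>\<^sub>C real)" where
  "linf_indicator C = Bcontfun (indicator C)"

lemma apply_linf_indicator: "apply_bcontfun (linf_indicator C) x = indicator C x"
proof -
  have "(indicator C :: 'a \<Rightarrow> real) \<in> bcontfun"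
    by (auto simp: bcontfun_def indicator_def intro!: boundedI[where B = 1])
  then show ?thesis by (simp add: linf_indicator_def Bcontfun_inverse)
qed

definition translate ::
    "'a::{ab_group_add, discrete_topology} \<Rightarrow> ('a \<Rightarrow>\<^sub>C real) \<Rightarrow> ('a \<Rightarrow>\<^sub>C real)" where
  "translate g f = Bcontfun (\<lambda>x. f (x - g))"

lemma apply_translate: "apply_bcontfun (translate g f) x = f (x - g)"
proof -
  have "bounded (range (\<lambda>x. f (x - g)))"
    by (rule bounded_subset[OF bounded_apply_bcontfun[of f]]) auto
  then have "(\<lambda>x. apply_bcontfun f (x - g)) \<in> bcontfun"
    by (simp add: bcontfun_def)
  then show ?thesis by (simp add: translate_def Bcontfun_inverse)
qed

text \<open>Means are taken in the dual space, where convexity and extreme points are available.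
  Continuity is no extra requirement: see \<open>mean_automatically_bounded\<close> below.\<close>

definition is_mean :: "(('a::discrete_topology \<Rightarrow>\<^sub>C real) \<Rightarrow>\<^sub>L real) \<Rightarrow> bool" where
  "is_mean m \<longleftrightarrow> m (linf_indicator UNIV) = 1 \<and>
     (\<forall>f. (\<forall>x. 0 \<le> apply_bcontfun f x \<and> apply_bcontfun f x \<le> 1) \<longrightarrow> 0 \<le> m f)"

lemma mean_automatically_bounded:
  fixes m :: "('a::discrete_topology \<Rightarrow>\<^sub>C real) \<Rightarrow> real"
  assumes lin: "linear m"
    and one: "m (linf_indicator UNIV) = 1"
    and pos: "\<And>f. (\<forall>x. 0 \<le> apply_bcontfun f x \<and> apply_bcontfun f x \<le> 1) \<Longrightarrow> 0 \<le> m f"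
  shows "bounded_linear m"
proof -
  interpret linear m by (rule lin)
  have up: "m f \<le> norm f" for f
  proof (cases "f = 0")
    case True
    then show ?thesis by (simp add: zero)
  next
    case False
    define c where "c = norm f"
    have c: "c > 0" using False by (simp add: c_def)
    have le: "\<bar>apply_bcontfun f x\<bar> \<le> c" for x
      using norm_bounded[of f x] by (simp add: c_def)
    let ?g = "(1/2) *\<^sub>R (linf_indicator UNIV - (1/c) *\<^sub>R f)"
    have "0 \<le> apply_bcontfun ?g x \<and> apply_bcontfun ?g x \<le> 1" for x
      using le[of x] c by (auto simp: apply_linf_indicator field_simps abs_le_iff)
    then have "0 \<le> m ?g" by (intro pos) blast
    also have "m ?g = (1/2) * (1 - m f / c)"
      by (simp add: scale diff one)
    finally show ?thesis using c by (simp add: c_def field_simps)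
  qed
  have "\<bar>m f\<bar> \<le> norm f" for f
    using up[of f] up[of "- f"] by (simp add: neg)
  then show ?thesis
    by (intro bounded_linear_intro[where K = 1]) (auto simp: add scale)
qed

definition invariant_means ::
    "(('a::{ab_group_add, discrete_topology} \<Rightarrow>\<^sub>C real) \<Rightarrow>\<^sub>L real) set" where
  "invariant_means = {m. is_mean m \<and> (\<forall>g f. m (translate g f) = m f)}"

definition mean_of_set ::
    "(('a::discrete_topology \<Rightarrow>\<^sub>C real) \<Rightarrow>\<^sub>L real) \<Rightarrow> 'a set \<Rightarrow> real" where
  "mean_of_set m C = m (linf_indicator C)"


section \<open>Nets\<close>

text \<open>The relation need not be reflexive or antisymmetric. The empty set is excluded, since nets
  on it have no limits.\<close>

definition directed_set :: "'i set \<Rightarrow> ('i \<Rightarrow> 'i \<Rightarrow> bool) \<Rightarrow> bool" where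
  "directed_set I le \<longleftrightarrow> I \<noteq> {} \<and>
     (\<forall>i\<in>I. \<forall>j\<in>I. \<forall>k\<in>I. le i j \<longrightarrow> le j k \<longrightarrow> le i k) \<and>
     (\<forall>i\<in>I. \<forall>j\<in>I. \<exists>k\<in>I. le i k \<and> le j k)"

definition net_filter :: "'i set \<Rightarrow> ('i \<Rightarrow> 'i \<Rightarrow> bool) \<Rightarrow> 'i filter" where
  "net_filter I le = (INF i\<in>I. principal {j\<in>I. le i j})"

lemma eventually_net_filter:
  assumes "directed_set I le"
  shows "eventually P (net_filter I le) \<longleftrightarrow> (\<exists>i\<in>I. \<forall>j\<in>I. le i j \<longrightarrow> P j)"
proof -
  have "eventually P (net_filter I le) \<longleftrightarrow> (\<exists>i\<in>I. eventually P (principal {j\<in>I. le i j}))"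
    unfolding net_filter_def
  proof (rule eventually_INF_base)
    show "I \<noteq> {}" using assms by (simp add: directed_set_def)
    fix a b assume ab: "a \<in> I" "b \<in> I"
    then obtain k where k: "k \<in> I" "le a k" "le b k"
      using assms unfolding directed_set_def by blast
    have "{j \<in> I. le k j} \<subseteq> {j \<in> I. le a j} \<inter> {j \<in> I. le b j}"
      using assms ab k unfolding directed_set_def by blast
    then show "\<exists>x\<in>I. principal {j \<in> I. le x j}
        \<le> inf (principal {j \<in> I. le a j}) (principal {j \<in> I. le b j})"
      using k(1) by auto
  qed
  then show ?thesis by (auto simp: eventually_principal)
qed

lemma net_filter_neq_bot:
  assumes "directed_set I le"
  shows "net_filter I le \<noteq> bot"
proof -
  have "\<not> eventually (\<lambda>_. False) (net_filter I le)"
    unfolding eventually_net_filter[OF assms] using assms unfolding directed_set_def by blast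
  then show ?thesis by (auto simp: trivial_limit_def)
qed

text \<open>Used only for bounded nets, for which the inner infimum (supremum) is a genuine one and the
  outer limit exists by monotonicity.\<close>

definition net_liminf :: "'i set \<Rightarrow> ('i \<Rightarrow> 'i \<Rightarrow> bool) \<Rightarrow> ('i \<Rightarrow> real) \<Rightarrow> real" where
  "net_liminf I le x = Lim (net_filter I le) (\<lambda>i. INF j\<in>{j\<in>I. le i j}. x j)"

definition net_limsup :: "'i set \<Rightarrow> ('i \<Rightarrow> 'i \<Rightarrow> bool) \<Rightarrow> ('i \<Rightarrow> real) \<Rightarrow> real" where
  "net_limsup I le x = Lim (net_filter I le) (\<lambda>i. SUP j\<in>{j\<in>I. le i j}. x j)"

text \<open>\<open>subnet_map I le J le' h\<close>: for every net \<open>y\<close> on \<open>(I, le)\<close>, the composite \<open>y \<circ> h\<close> on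
  \<open>(J, le')\<close> is a subnet of \<open>y\<close>.

  HOL cannot quantify existentially over the type of \<open>J\<close>. If \<open>y\<close> is a net of finite subsets of
  \<open>'a\<close> and one asks for a subnet \<open>y \<circ> h\<close> and sets \<open>\<Psi> j \<subseteq> y (h j)\<close> for which \<open>\<Psi>\<close> is Folner,
  finitely many given sets have a density along \<open>\<Psi>\<close>, and a lower bound on the limit inferior of
  \<open>card (\<Psi> j) / card (y (h j))\<close> holds, then \<open>'i \<times> 'a set \<times> nat\<close> is large enough to hold an index
  set whenever any type is: index by the triples \<open>(i, F, n)\<close> with \<open>F\<close> finite for which some subset
  of \<open>y i\<close> meets all these requirements up to \<open>1 / (n + 1)\<close>, with invariance tested on \<open>F\<close>.\<close>

definition subnet_map ::
    "'i set \<Rightarrow> ('i \<Rightarrow> 'i \<Rightarrow> bool) \<Rightarrow> 'j set \<Rightarrow> ('j \<Rightarrow> 'j \<Rightarrow> bool) \<Rightarrow> ('j \<Rightarrow> 'i) \<Rightarrow> bool" where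
  "subnet_map I le J le' h \<longleftrightarrow> directed_set J le' \<and> h ` J \<subseteq> I \<and>
     (\<forall>j1\<in>J. \<forall>j2\<in>J. le' j1 j2 \<longrightarrow> le (h j1) (h j2)) \<and>
     (\<forall>i0\<in>I. \<exists>j\<in>J. le i0 (h j))"


section \<open>Folner nets and densities\<close>

definition folner_net ::
    "'i set \<Rightarrow> ('i \<Rightarrow> 'i \<Rightarrow> bool) \<Rightarrow> ('i \<Rightarrow> 'a::ab_group_add set) \<Rightarrow> bool" where
  "folner_net I le \<Phi> \<longleftrightarrow> directed_set I le \<and>
     (\<forall>i\<in>I. finite (\<Phi> i) \<and> \<Phi> i \<noteq> {}) \<and>
     (\<forall>t. ((\<lambda>i. real (card (sym_diff (\<Phi> i) ((\<lambda>x. x + t) ` \<Phi> i))) / real (card (\<Phi> i)))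
            \<longlongrightarrow> 0) (net_filter I le))"

abbreviation folner_sequence :: "(nat \<Rightarrow> 'a::ab_group_add set) \<Rightarrow> bool" where
  "folner_sequence \<equiv> folner_net UNIV (\<le>)"

definition lower_density ::
    "'i set \<Rightarrow> ('i \<Rightarrow> 'i \<Rightarrow> bool) \<Rightarrow> ('i \<Rightarrow> 'a set) \<Rightarrow> 'a set \<Rightarrow> real" where
  "lower_density I le \<Phi> C = net_liminf I le (\<lambda>j. real (card (C \<inter> \<Phi> j)) / real (card (\<Phi> j)))"

definition upper_density ::
    "'i set \<Rightarrow> ('i \<Rightarrow> 'i \<Rightarrow> bool) \<Rightarrow> ('i \<Rightarrow> 'a set) \<Rightarrow> 'a set \<Rightarrow> real" where
  "upper_density I le \<Phi> C = net_limsup I le (\<lambda>j. real (card (C \<inter> \<Phi> j)) / real (card (\<Phi> j)))"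

definition has_density ::
    "'i set \<Rightarrow> ('i \<Rightarrow> 'i \<Rightarrow> bool) \<Rightarrow> ('i \<Rightarrow> 'a set) \<Rightarrow> 'a set \<Rightarrow> real \<Rightarrow> bool" where
  "has_density I le \<Phi> C d \<longleftrightarrow> lower_density I le \<Phi> C = d \<and> upper_density I le \<Phi> C = d"

end

theory Submission
  imports Defs
begin

text \<open>Let \<open>m\<close> be an invariant mean which is a limit of averages over the sets \<open>\<Phi> i\<close> and satisfies
  \<open>m A + m B - m (A + B) \<ge> \<delta>\<close> (up to an error). By the weak* Krein--Milman theorem, \<open>m\<close> splits
  into positive invariant functionals \<open>m1\<close> and \<open>m - m1\<close> such that \<open>m1\<close> behaves like the extreme
  means of the hypothesis, while \<open>m - m1\<close> contributes nothing positive to \<open>\<delta>\<close>. As \<open>m1 \<le> m\<close>,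
  \<open>m1\<close> is approximately \<open>m\<close> with a density \<open>f\<close> with values in \<open>[0, 1]\<close>. Since both functionals are
  invariant, so is \<open>f\<close> approximately, and by averaging some level set \<open>C\<close> of \<open>f\<close> is almost invariant
  and inherits the properties of \<open>m1\<close>. The sets \<open>\<Psi>\<close> are the intersections \<open>C \<inter> \<Phi> i\<close>, for \<open>i\<close> so
  large that averages over \<open>\<Phi> i\<close> are close to \<open>m\<close>. The bound on their size comes from
  \<open>\<Sum>r\<in>R. h (x - r) = 1\<close>, where \<open>h = 1\<^bsub>A+K\<^esub> + 1\<^bsub>B+K\<^esub> - 1\<^bsub>A+B+K\<^esub>\<close> and \<open>R\<close> is a transversal of
  \<open>K\<close>.\<close>


section \<open>A weak* Krein--Milman theorem\<close>

text \<open>No requirement on the size of \<open>C\<close> enters the choice of a level set. It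
  follows afterwards: on \<open>C\<close> the integral of \<open>h\<close> is about
  \<open>\<delta>\<close> or more, its translates by elements of \<open>R\<close> have nearly the
  same integrals since \<open>C\<close> is almost invariant, and these integrals add up to the size
  of \<open>C\<close>. That the translates of \<open>h\<close> add up to 1, and not to another
  constant, is the second equation assumed of the extreme means, carried over to \<open>m1\<close>.
  A finitely additive \<open>m1\<close> need not have an exact density with respect to
  \<open>m\<close>, hence the approximations, with only finitely many translations tested at a time.
  Lower densities enter asymmetrically. Every limit mean is at least the lower density on
  \<open>A\<close> and \<open>B\<close>, but it is close to it on \<open>A + B\<close> only if the
  limit is taken along indices where that ratio is small. The densities along \<open>\<Psi>\<close>
  cannot be prescribed; they are found by compactness before any index set is built.\<close>

definition extremal_in :: "'b::real_vector set \<Rightarrow> 'b set \<Rightarrow> bool" where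
  "extremal_in S T \<longleftrightarrow> T \<subseteq> S \<and> (\<forall>a\<in>S. \<forall>b\<in>S. \<forall>x\<in>T. x \<in> open_segment a b \<longrightarrow> a \<in> T \<and> b \<in> T)"

text \<open>A point of \<open>T\<close> with value at least \<open>c\<close> is a convex
  combination, with both weights positive, of end points that lie in \<open>T\<close> and so have
  value at most \<open>c\<close>; hence both attain \<open>c\<close>.\<close>

lemma extremal_in_argmax:
  fixes S :: "('v::real_normed_vector \<Rightarrow>\<^sub>L real) set"
  assumes T: "extremal_in S T" and max: "\<And>x. x \<in> T \<Longrightarrow> blinfun_apply x f \<le> c"
  shows "extremal_in S {x \<in> T. c \<le> blinfun_apply x f}"
  unfolding extremal_in_def
proof (intro conjI ballI impI)
  show "{x \<in> T. c \<le> blinfun_apply x f} \<subseteq> S"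
    using T by (auto simp: extremal_in_def)
next
  fix a b x assume ab: "a \<in> S" "b \<in> S" and x: "x \<in> {x \<in> T. c \<le> blinfun_apply x f}"
    and seg: "x \<in> open_segment a b"
  have "a \<in> T" "b \<in> T" using T ab x seg unfolding extremal_in_def by blast+
  then have le: "a f \<le> c" "b f \<le> c" by (auto intro: max)
  obtain u where u: "0 < u" "u < 1" "x = (1 - u) *\<^sub>R a + u *\<^sub>R b"
    using seg by (auto simp: in_segment)
  have eq: "c \<le> (1 - u) * a f + u * b f"
    using x u(3) by (simp add: plus_blinfun.rep_eq scaleR_blinfun.rep_eq)
  have "u * b f \<le> u * c" "(1 - u) * a f \<le> (1 - u) * c"
    using le u by (auto intro: mult_left_mono)
  then have "(1 - u) * c \<le> (1 - u) * a f" "u * c \<le> u * b f"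
    using eq by (simp_all add: algebra_simps)
  then have "c \<le> a f" "c \<le> b f" using u by auto
  then show "a \<in> {x \<in> T. c \<le> blinfun_apply x f}" "b \<in> {x \<in> T. c \<le> blinfun_apply x f}"
    using \<open>a \<in> T\<close> \<open>b \<in> T\<close> by auto
qed

lemma extremal_in_Inter:
  assumes "\<And>T. T \<in> \<T> \<Longrightarrow> extremal_in S T" "\<T> \<noteq> {}"
  shows "extremal_in S (\<Inter>\<T>)"
  using assms unfolding extremal_in_def by blast

lemma extremal_in_singleton:
  assumes "extremal_in S {x}"
  shows "x extreme_point_of S"
  using assms by (auto simp: extremal_in_def extreme_point_of_def open_segment_def)

text \<open>Zorn's lemma on the closed faces inside the set where \<open>f\<close> is maximal: a
  minimal one is a singleton. Compactness is assumed of the image under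
  \<open>blinfun_apply\<close>, that is, for pointwise convergence, which is the weak*
  topology.\<close>

lemma extreme_point_maximizer_exists:
  fixes S :: "('v::real_normed_vector \<Rightarrow>\<^sub>L real) set"
  assumes comp: "compact (blinfun_apply ` S)" and ne: "S \<noteq> {}"
  obtains \<nu> where "\<nu> extreme_point_of S" "\<And>x. x \<in> S \<Longrightarrow> blinfun_apply x f \<le> blinfun_apply \<nu> f"
proof -
  \<comment> \<open>Faces are described by closed sets \<open>Z\<close> of arbitrary functions,
    since compactness holds in the function space and not in the norm topology of the dual.\<close>
  define face where "face Z = {x \<in> S. blinfun_apply x \<in> Z}" for Z
  have cont: "continuous_on X (\<lambda>u::'v \<Rightarrow> real. u g)" for X g
    by (rule continuous_on_subset[OF continuous_on_product_coordinates]) auto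
  have maximizer: "\<exists>x\<in>face Z. \<forall>y\<in>face Z. y g \<le> x g" if "closed Z" "face Z \<noteq> {}" for Z g
  proof -
    have eq: "blinfun_apply ` face Z = blinfun_apply ` S \<inter> Z" by (auto simp: face_def)
    have "compact (blinfun_apply ` face Z)" unfolding eq
      by (rule compact_Int_closed[OF comp \<open>closed Z\<close>])
    from continuous_attains_sup[OF this _ cont[of _ g]] that(2) show ?thesis by auto
  qed
  have subface: "\<exists>Z'. closed Z' \<and> Z' \<subseteq> Z \<and> face Z' \<noteq> {} \<and> extremal_in S (face Z') \<and>
      (\<exists>x\<in>face Z. face Z' = {y\<in>face Z. x g \<le> y g} \<and> (\<forall>y\<in>face Z. y g \<le> x g))"
    if Z: "closed Z" "face Z \<noteq> {}" "extremal_in S (face Z)" for Z g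
  proof -
    obtain x where x: "x \<in> face Z" "\<forall>y\<in>face Z. y g \<le> x g" using maximizer[OF Z(1,2)] by blast
    define Z' where "Z' = Z \<inter> {u. x g \<le> u g}"
    have "closed Z'" unfolding Z'_def
      by (intro closed_Int Z(1) closed_Collect_le continuous_on_const cont)
    moreover have "face Z' = {y\<in>face Z. x g \<le> y g}" by (auto simp: face_def Z'_def)
    moreover have "extremal_in S {y\<in>face Z. x g \<le> y g}"
      using x by (intro extremal_in_argmax Z(3)) auto
    ultimately show ?thesis using x unfolding Z'_def by (intro exI[of _ Z']) (auto simp: Z'_def)
  qed
  have faceU: "face UNIV = S" by (auto simp: face_def)
  obtain Z0 x0 where Z0: "closed Z0" "face Z0 \<noteq> {}" "extremal_in S (face Z0)"
    and x0: "x0 \<in> S" "face Z0 = {y\<in>S. x0 f \<le> y f}" "\<forall>y\<in>S. y f \<le> x0 f"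
  proof -
    have "extremal_in S (face UNIV)" by (simp add: faceU extremal_in_def)
    have "\<exists>Z' x. closed Z' \<and> face Z' \<noteq> {} \<and> extremal_in S (face Z') \<and> x \<in> S \<and>
        face Z' = {y\<in>S. x f \<le> y f} \<and> (\<forall>y\<in>S. y f \<le> x f)"
      using subface[OF closed_UNIV _ \<open>extremal_in S (face UNIV)\<close>, of f] ne unfolding faceU by blast
    then show ?thesis using that by blast
  qed
  \<comment> \<open>Complements turn the minimal closed set that is wanted into a maximal element,
    and intersections of chains into unions.\<close>
  define \<A> where "\<A> = uminus ` {Z. closed Z \<and> Z \<subseteq> Z0 \<and> face Z \<noteq> {} \<and> extremal_in S (face Z)}"
  have "\<exists>M\<in>\<A>. \<forall>X\<in>\<A>. M \<subseteq> X \<longrightarrow> X = M"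
  proof (rule subset_Zorn_nonempty)
    show "\<A> \<noteq> {}" using Z0 by (auto simp: \<A>_def)
    fix \<C> assume \<C>: "\<C> \<noteq> {}" "subset.chain \<A> \<C>"
    define \<Z> where "\<Z> = uminus ` \<C>"
    have \<Z>: "closed Z \<and> Z \<subseteq> Z0 \<and> face Z \<noteq> {} \<and> extremal_in S (face Z)" if "Z \<in> \<Z>" for Z
      using that \<C>(2) by (auto simp: \<Z>_def \<A>_def subset_chain_def)
    have \<Z>_ne: "\<Z> \<noteq> {}" using \<C> by (simp add: \<Z>_def)
    have chain: "subset.chain UNIV \<Z>"
      using \<C>(2) by (auto simp: \<Z>_def subset_chain_def)
    have face_Inter: "face (\<Inter>\<Z>) = \<Inter>(face ` \<Z>)" using \<Z>_ne by (auto simp: face_def)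
    have "blinfun_apply ` S \<inter> \<Inter>\<Z> \<noteq> {}"
    proof (rule compact_imp_fip[OF comp])
      show "closed T" if "T \<in> \<Z>" for T using \<Z>[OF that] by simp
      fix \<F> assume \<F>: "finite \<F>" "\<F> \<subseteq> \<Z>"
      show "blinfun_apply ` S \<inter> \<Inter>\<F> \<noteq> {}"
      proof (cases "\<F> = {}")
        case False
        then have "\<Inter>\<F> \<in> \<F>" using \<F> chain
          by (intro Inter_in_chain[where \<A> = UNIV]) (auto simp: subset_chain_def)
        then have "face (\<Inter>\<F>) \<noteq> {}" using \<Z> \<F> by blast
        then show ?thesis by (auto simp: face_def)
      qed (use ne in auto)
    qed
    then have "face (\<Inter>\<Z>) \<noteq> {}" by (auto simp: face_def)
    moreover have "extremal_in S (face (\<Inter>\<Z>))" unfolding face_Inter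
      using \<Z> \<Z>_ne by (intro extremal_in_Inter) auto
    moreover have "closed (\<Inter>\<Z>)" using \<Z> by (intro closed_Inter) auto
    moreover have "\<Inter>\<Z> \<subseteq> Z0" using \<Z> \<Z>_ne by blast
    moreover have "\<Union>\<C> = - \<Inter>\<Z>" by (auto simp: \<Z>_def)
    ultimately show "\<Union>\<C> \<in> \<A>" by (auto simp: \<A>_def)
  qed
  then obtain M where M: "M \<in> \<A>" "\<And>X. X \<in> \<A> \<Longrightarrow> M \<subseteq> X \<Longrightarrow> X = M" by blast
  define Z where "Z = - M"
  have Z: "closed Z" "Z \<subseteq> Z0" "face Z \<noteq> {}" "extremal_in S (face Z)"
    using M(1) by (auto simp: Z_def \<A>_def)
  have min: "Z' = Z" if "closed Z'" "Z' \<subseteq> Z" "face Z' \<noteq> {}" "extremal_in S (face Z')" for Z'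
  proof -
    have "- Z' \<in> \<A>" using that Z(2) unfolding \<A>_def by (intro imageI) simp
    moreover have "M \<subseteq> - Z'" using that(2) by (auto simp: Z_def)
    ultimately have "- Z' = M" by (rule M(2))
    then show ?thesis by (auto simp: Z_def)
  qed
  obtain \<nu> where \<nu>: "\<nu> \<in> face Z" using Z by blast
  \<comment> \<open>By minimality, passing to the points of the face with the largest value at
    \<open>g\<close> changes nothing, so all points of the face agree at every
    \<open>g\<close>.\<close>
  have "y = \<nu>" if y: "y \<in> face Z" for y
  proof (rule blinfun_eqI)
    fix g
    obtain Z' x where "closed Z'" "Z' \<subseteq> Z" "face Z' \<noteq> {}" "extremal_in S (face Z')"
      and x: "x \<in> face Z" "face Z' = {y\<in>face Z. x g \<le> y g}" "\<forall>y\<in>face Z. y g \<le> x g"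
      using subface[OF Z(1,3,4), of g] by blast
    then have "Z' = Z" using min by blast
    then show "y g = \<nu> g" using x y \<nu> by (metis (no_types, lifting) antisym mem_Collect_eq)
  qed
  then have "face Z = {\<nu>}" using \<nu> by blast
  then have "\<nu> extreme_point_of S" using Z(4) by (intro extremal_in_singleton) simp
  moreover have "x f \<le> \<nu> f" if "x \<in> S" for x
  proof -
    have "\<nu> \<in> face Z0" using \<nu> Z(2) by (auto simp: face_def)
    then show ?thesis using x0 that by force
  qed
  ultimately show ?thesis by (rule that)
qed

text \<open>By compactness finitely many vectors \<open>F\<close> already tell \<open>m\<close>
  apart from all of \<open>D\<close>, which reduces the claim to Euclidean projection:
  \<open>a\<close> is a point of \<open>D\<close> nearest to \<open>m\<close> in the coordinates
  \<open>F\<close>. The normal vector \<open>m - a\<close> is realised by a vector \<open>V\<close>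
  of the underlying space, so the separation is by an evaluation.\<close>

lemma weak_star_separation:
  fixes D :: "('v::real_normed_vector \<Rightarrow>\<^sub>L real) set"
  assumes comp: "compact (blinfun_apply ` D)" and conv: "convex D" and ne: "D \<noteq> {}"
    and notin: "m \<notin> D"
  obtains f c where "\<And>d. d \<in> D \<Longrightarrow> blinfun_apply d f \<le> c" "c < blinfun_apply m f"
proof -
  have cont: "continuous_on X (\<lambda>u::'v \<Rightarrow> real. u g)" for X g
    by (rule continuous_on_subset[OF continuous_on_product_coordinates]) auto
  have "\<exists>F. finite F \<and> (\<forall>d\<in>D. \<exists>f\<in>F. d f \<noteq> m f)"
  proof (rule ccontr)
    assume *: "\<not> ?thesis"
    have "blinfun_apply ` D \<inter> (\<Inter>f\<in>UNIV. {u. u f = m f}) \<noteq> {}"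
    proof (rule compact_imp_fip_image[OF comp])
      show "closed {u. u f = m f}" for f
        by (intro closed_Collect_eq continuous_on_const cont)
      show "blinfun_apply ` D \<inter> (\<Inter>f\<in>F. {u. u f = m f}) \<noteq> {}" if "finite F" for F
        using * that by fastforce
    qed
    then obtain d where "d \<in> D" "\<And>f. d f = m f" by auto
    then show False using notin blinfun_eqI[of d m] by auto
  qed
  then obtain F where F: "finite F" "\<And>d. d \<in> D \<Longrightarrow> \<exists>f\<in>F. d f \<noteq> m f" by blast
  have "\<exists>u\<in>blinfun_apply ` D. \<forall>w\<in>blinfun_apply ` D.
      (\<Sum>f\<in>F. (u f - m f)\<^sup>2) \<le> (\<Sum>f\<in>F. (w f - m f)\<^sup>2)"
    using ne by (intro continuous_attains_inf comp continuous_intros cont) auto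
  then obtain a where a: "a \<in> D" "\<And>d. d \<in> D \<Longrightarrow> (\<Sum>f\<in>F. (a f - m f)\<^sup>2) \<le> (\<Sum>f\<in>F. (d f - m f)\<^sup>2)"
    by auto
  define v where "v f = m f - a f" for f
  define V where "V = (\<Sum>f\<in>F. v f *\<^sub>R f)"
  have app: "blinfun_apply d V = (\<Sum>f\<in>F. v f * d f)" for d
    by (simp add: V_def blinfun.sum_right blinfun.scaleR_right)
  have "d V \<le> a V" if d: "d \<in> D" for d
  proof (rule ccontr)
    define p where "p = (\<Sum>f\<in>F. v f * (d f - a f))"
    define q where "q = (\<Sum>f\<in>F. (d f - a f)\<^sup>2)"
    assume "\<not> d V \<le> a V"
    then have p: "p > 0" by (simp add: app p_def right_diff_distrib sum_subtractf)
    have q: "q \<ge> 0" by (auto simp: q_def intro: sum_nonneg)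
    \<comment> \<open>Moving from \<open>a\<close> towards \<open>d\<close> by \<open>t\<close>
      changes the squared distance by \<open>t\<^sup>2 * q - 2 * t * p\<close>, which is negative
      since \<open>t * q < 2 * p\<close>. The bound 1 keeps the point in \<open>D\<close>;
      \<open>q + 1\<close> avoids a zero denominator.\<close>
    define t where "t = min 1 (p / (q + 1))"
    have t: "0 < t" "t \<le> 1" "t \<le> p / (q + 1)" using p q by (simp_all add: t_def)
    have tq: "t * (q + 1) \<le> p" using t(3) q by (simp add: pos_le_divide_eq)
    have "(1 - t) *\<^sub>R a + t *\<^sub>R d \<in> D" using conv a(1) d t
      by (auto simp: convex_alt)
    from a(2)[OF this]
    have "(\<Sum>f\<in>F. (v f)\<^sup>2) \<le> (\<Sum>f\<in>F. (t * (d f - a f) - v f)\<^sup>2)"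
      by (simp add: v_def blinfun.add_left blinfun.scaleR_left power2_commute[of "m f" "a f" for f])
        (simp add: algebra_simps)
    also have "\<dots> = (\<Sum>f\<in>F. t\<^sup>2 * (d f - a f)\<^sup>2 - 2 * t * (v f * (d f - a f)) + (v f)\<^sup>2)"
      by (intro sum.cong refl) (simp add: power2_eq_square algebra_simps)
    also have "\<dots> = t\<^sup>2 * q - 2 * t * p + (\<Sum>f\<in>F. (v f)\<^sup>2)"
      by (simp add: sum.distrib sum_subtractf p_def q_def sum_distrib_left)
    finally have "t * (2 * p) \<le> t * (t * q)" by (simp add: power2_eq_square algebra_simps)
    then have "2 * p \<le> t * q" using t by simp
    then show False using t(1) tq p by (simp add: algebra_simps)
  qed
  moreover have "a V < m V"
  proof -
    obtain f where f: "f \<in> F" "a f \<noteq> m f" using F(2)[OF a(1)] by blast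
    have "0 < (\<Sum>f\<in>F. (v f)\<^sup>2)" using F(1) f by (intro sum_pos2[where i = f]) (auto simp: v_def)
    also have "\<dots> = m V - a V"
      by (simp add: app v_def power2_eq_square sum_subtractf[symmetric] algebra_simps)
    finally show ?thesis by simp
  qed
  ultimately show ?thesis by (rule that)
qed

text \<open>A point of \<open>S\<close> outside \<open>D\<close> would be separated from
  \<open>D\<close> by an evaluation at some \<open>f\<close>, whose maximum on \<open>S\<close> is
  attained at an extreme point, hence in \<open>D\<close>. A general \<open>D\<close> replaces the
  closed convex hull of the extreme points, so that it can be the set of means that decompose as
  desired.\<close>

theorem weak_star_Krein_Milman:
  fixes S D :: "('v::real_normed_vector \<Rightarrow>\<^sub>L real) set"
  assumes S: "compact (blinfun_apply ` S)" and D: "compact (blinfun_apply ` D)" "convex D"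
    and ext: "\<And>\<nu>. \<nu> extreme_point_of S \<Longrightarrow> \<nu> \<in> D"
  shows "S \<subseteq> D"
proof
  fix m assume m: "m \<in> S"
  then have ne: "S \<noteq> {}" by blast
  show "m \<in> D"
  proof (rule ccontr)
    assume "m \<notin> D"
    moreover have "D \<noteq> {}" using extreme_point_maximizer_exists[OF S ne] ext by blast
    ultimately obtain f c where fc: "\<And>d. d \<in> D \<Longrightarrow> blinfun_apply d f \<le> c" "c < blinfun_apply m f"
      using weak_star_separation[OF D] by metis
    obtain \<nu> where "\<nu> extreme_point_of S" "\<And>x. x \<in> S \<Longrightarrow> blinfun_apply x f \<le> blinfun_apply \<nu> f"
      using extreme_point_maximizer_exists[OF S ne] by blast
    then show False using fc ext m by force
  qed
qed

text \<open>The image of the unit ball is cut out of a product of compact intervals by linearity, a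
  family of closed conditions on finitely many coordinates each.\<close>

theorem Banach_Alaoglu:
  "compact (blinfun_apply ` {m :: 'v::real_normed_vector \<Rightarrow>\<^sub>L real. norm m \<le> 1})"
proof -
  have cont: "continuous_on X (\<lambda>u::'v \<Rightarrow> real. u g)" for X g
    by (rule continuous_on_subset[OF continuous_on_product_coordinates]) auto
  define L where "L = {u :: 'v \<Rightarrow> real. (\<forall>f g. u (f + g) = u f + u g) \<and> (\<forall>c f. u (c *\<^sub>R f) = c * u f)}"
  define B where "B = PiE UNIV (\<lambda>f :: 'v. {- norm f .. norm f})"
  have "compactin (product_topology (\<lambda>i. euclidean) UNIV) B"
    unfolding B_def compactin_PiE by (auto simp: compactin_euclidean_iff)
  then have "compact B"
    by (simp add: euclidean_product_topology compactin_euclidean_iff)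
  moreover have "closed L" unfolding L_def
    by (intro closed_Collect_conj closed_Collect_all closed_Collect_eq continuous_intros cont)
  moreover have "blinfun_apply ` {m. norm m \<le> 1} = B \<inter> L"
  proof (intro equalityI subsetI)
    fix u assume "u \<in> blinfun_apply ` {m :: 'v \<Rightarrow>\<^sub>L real. norm m \<le> 1}"
    then obtain m where m: "u = blinfun_apply m" "norm m \<le> 1" by blast
    have "\<bar>m f\<bar> \<le> norm f" for f
      using norm_blinfun[of m f] m(2) mult_right_mono[OF m(2) norm_ge_zero[of f]] by simp
    then have "\<And>f. - norm f \<le> m f" "\<And>f. m f \<le> norm f" by (auto simp: abs_le_iff minus_le_iff)
    then show "u \<in> B \<inter> L" by (auto simp: m(1) B_def L_def blinfun.add_right blinfun.scaleR_right)
  next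
    fix u assume u: "u \<in> B \<inter> L"
    then have le: "\<bar>u f\<bar> \<le> norm f" for f
      by (auto simp: B_def abs_le_iff PiE_iff minus_le_iff)
    then have "bounded_linear u" using u
      by (intro bounded_linear_intro[where K = 1]) (auto simp: L_def)
    then have "blinfun_apply (Blinfun u) = u" by (rule bounded_linear_Blinfun_apply)
    moreover from this have "norm (Blinfun u) \<le> 1"
      using le by (intro norm_blinfun_bound) auto
    ultimately show "u \<in> blinfun_apply ` {m. norm m \<le> 1}"
      by (intro image_eqI[where x = "Blinfun u"]) auto
  qed
  ultimately show ?thesis by (metis compact_Int_closed)
qed


section \<open>Decomposition of invariant means\<close>

text \<open>No normalisation is imposed, since the two summands of a mean need not have mass 1 and
  one of them may be 0.\<close>

definition positive_invariant ::
    "(('a::{ab_group_add, discrete_topology} \<Rightarrow>\<^sub>C real) \<Rightarrow>\<^sub>L real) set" where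
  "positive_invariant = {m. (\<forall>f. (\<forall>x. 0 \<le> apply_bcontfun f x) \<longrightarrow> 0 \<le> blinfun_apply m f) \<and>
     (\<forall>g f. blinfun_apply m (translate g f) = blinfun_apply m f)}"

text \<open>A nonnegative bounded function is a multiple of one with values between 0 and 1, so
  testing positivity on the latter is enough.\<close>

lemma invariant_means_iff:
  "m \<in> invariant_means \<longleftrightarrow> m \<in> positive_invariant \<and> blinfun_apply m (linf_indicator UNIV) = 1"
proof -
  have "0 \<le> m f" if m: "\<forall>f. (\<forall>x. 0 \<le> apply_bcontfun f x \<and> apply_bcontfun f x \<le> 1) \<longrightarrow> 0 \<le> m f"
    and f: "\<forall>x. 0 \<le> apply_bcontfun f x" for m :: "('a \<Rightarrow>\<^sub>C real) \<Rightarrow>\<^sub>L real" and f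
  proof -
    define c where "c = norm f + 1"
    have c: "c > 0" using norm_ge_zero[of f] unfolding c_def by linarith
    have "apply_bcontfun f x \<le> c" for x using norm_bounded[of f x] by (simp add: c_def)
    then have "0 \<le> m ((1 / c) *\<^sub>R f)" using f c by (intro m[rule_format]) auto
    then show ?thesis using c by (simp add: blinfun.scaleR_right zero_le_divide_iff)
  qed
  then show ?thesis
    unfolding invariant_means_def is_mean_def positive_invariant_def by blast
qed

lemma positive_invariant_norm:
  fixes m :: "('a::{ab_group_add, discrete_topology} \<Rightarrow>\<^sub>C real) \<Rightarrow>\<^sub>L real"
  assumes m: "m \<in> positive_invariant" and one: "blinfun_apply m (linf_indicator UNIV) \<le> 1"
  shows "norm m \<le> 1"
proof (rule norm_blinfun_bound)
  fix f :: "'a \<Rightarrow>\<^sub>C real"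
  have "\<bar>apply_bcontfun f x\<bar> \<le> norm f" for x using norm_bounded[of f x] by simp
  then have le: "apply_bcontfun f x \<le> norm f" "0 \<le> norm f + apply_bcontfun f x" for x
    by (auto simp: abs_le_iff add.commute) (metis add.commute le_add_same_cancel1 minus_le_iff neg_le_iff_le real_0_le_add_iff)
  have "0 \<le> m (norm f *\<^sub>R linf_indicator UNIV - f)" "0 \<le> m (norm f *\<^sub>R linf_indicator UNIV + f)"
    using m le by (auto simp: positive_invariant_def apply_linf_indicator)
  then have "\<bar>m f\<bar> \<le> norm f * m (linf_indicator UNIV)"
    by (auto simp: blinfun.add_right blinfun.diff_right blinfun.scaleR_right abs_le_iff)
  also have "\<dots> \<le> 1 * norm f" using mult_left_mono[OF one norm_ge_zero[of f]] by simp
  finally show "norm (m f) \<le> 1 * norm f" by simp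
qed simp

lemma positive_invariant_zero: "0 \<in> positive_invariant"
  by (simp add: positive_invariant_def)

lemma convex_positive_invariant: "convex positive_invariant"
  unfolding convex_def positive_invariant_def
  by (auto simp: blinfun.add_left blinfun.scaleR_left intro!: add_nonneg_nonneg mult_nonneg_nonneg)

text \<open>The family \<open>h\<close> lets one statement serve for a single functional, for either
  component of a pair and for the difference of the components.\<close>

lemma closed_positive_invariant:
  fixes h :: "'z::topological_space \<Rightarrow> ('a::{ab_group_add, discrete_topology} \<Rightarrow>\<^sub>C real) \<Rightarrow> real"
  assumes "\<And>f. continuous_on UNIV (\<lambda>z. h z f)"
  shows "closed {z. (\<forall>f. (\<forall>x. 0 \<le> apply_bcontfun f x) \<longrightarrow> 0 \<le> h z f) \<and>
     (\<forall>g f. h z (translate g f) = h z f)}"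
  by (intro closed_Collect_conj closed_Collect_all closed_Collect_imp open_Collect_const
      closed_Collect_le closed_Collect_eq continuous_on_const assms)

lemma compact_invariant_means:
  "compact (blinfun_apply ` (invariant_means ::
     (('a::{ab_group_add, discrete_topology} \<Rightarrow>\<^sub>C real) \<Rightarrow>\<^sub>L real) set))"
proof -
  have cont: "continuous_on X (\<lambda>u::('a \<Rightarrow>\<^sub>C real) \<Rightarrow> real. u g)" for X g
    by (rule continuous_on_subset[OF continuous_on_product_coordinates]) auto
  define Z where "Z = {u :: ('a \<Rightarrow>\<^sub>C real) \<Rightarrow> real.
      (\<forall>f. (\<forall>x. 0 \<le> apply_bcontfun f x) \<longrightarrow> 0 \<le> u f) \<and> (\<forall>g f. u (translate g f) = u f)}
    \<inter> {u. u (linf_indicator UNIV) = 1}"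
  have "closed Z" unfolding Z_def
    by (intro closed_Int closed_positive_invariant closed_Collect_eq continuous_on_const cont)
  moreover have "invariant_means = {m. norm m \<le> 1 \<and> blinfun_apply m \<in> Z}"
    by (auto simp: Z_def invariant_means_iff intro!: positive_invariant_norm)
      (auto simp: positive_invariant_def)
  then have "blinfun_apply ` invariant_means = blinfun_apply ` {m. norm m \<le> 1} \<inter> Z" by auto
  ultimately show ?thesis by (metis compact_Int_closed Banach_Alaoglu)
qed

text \<open>The set of means having such a decomposition is weak* closed and convex, because the
  summand ranges over a weak* compact set; for an extreme mean the decomposition is the trivial one.
  This replaces an ergodic decomposition of the mean.\<close>

lemma invariant_mean_decomposition:
  fixes p :: "'a::{ab_group_add, discrete_topology} \<Rightarrow>\<^sub>C real"
  assumes ext: "\<And>\<nu> q. \<nu> extreme_point_of invariant_means \<Longrightarrow> 0 < blinfun_apply \<nu> p \<Longrightarrow> q \<in> Q \<Longrightarrow>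
      blinfun_apply \<nu> q = 0"
    and m: "m \<in> invariant_means"
  obtains m1 where "m1 \<in> positive_invariant" "m - m1 \<in> positive_invariant"
    "\<And>q. q \<in> Q \<Longrightarrow> blinfun_apply m1 q = 0" "blinfun_apply m p \<le> blinfun_apply m1 p"
proof -
  define R where "R = {(m, m1). m \<in> positive_invariant \<and> m1 \<in> positive_invariant \<and>
     m - m1 \<in> positive_invariant \<and> blinfun_apply m (linf_indicator UNIV) = 1 \<and>
     (\<forall>q\<in>Q. blinfun_apply m1 q = 0) \<and> blinfun_apply m p \<le> blinfun_apply m1 p}"
  have contp: "continuous_on X (\<lambda>z :: (('a \<Rightarrow>\<^sub>C real) \<Rightarrow> real) \<times> (('a \<Rightarrow>\<^sub>C real) \<Rightarrow> real). fst z g)"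
    "continuous_on X (\<lambda>z :: (('a \<Rightarrow>\<^sub>C real) \<Rightarrow> real) \<times> (('a \<Rightarrow>\<^sub>C real) \<Rightarrow> real). snd z g)" for X g
    by (rule continuous_on_product_then_coordinatewise, intro continuous_intros)+
  define P where "P h = {z :: (('a \<Rightarrow>\<^sub>C real) \<Rightarrow> real) \<times> (('a \<Rightarrow>\<^sub>C real) \<Rightarrow> real).
      (\<forall>f. (\<forall>x. 0 \<le> apply_bcontfun f x) \<longrightarrow> 0 \<le> h z f) \<and> (\<forall>g f. h z (translate g f) = h z f)}"
    for h :: "(('a \<Rightarrow>\<^sub>C real) \<Rightarrow> real) \<times> (('a \<Rightarrow>\<^sub>C real) \<Rightarrow> real) \<Rightarrow> ('a \<Rightarrow>\<^sub>C real) \<Rightarrow> real"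
  define Z where "Z = P fst \<inter> P snd \<inter> P (\<lambda>z f. fst z f - snd z f) \<inter>
      {z. fst z (linf_indicator UNIV) = 1 \<and> (\<forall>q\<in>Q. snd z q = 0) \<and> fst z p \<le> snd z p}"
  have "closed Z" unfolding Z_def P_def Ball_def
    by (intro closed_Int closed_positive_invariant closed_Collect_conj closed_Collect_all
        closed_Collect_imp open_Collect_const closed_Collect_eq closed_Collect_le
        continuous_intros contp)
  \<comment> \<open>As \<open>m1\<close> is dominated by \<open>m\<close>, its mass is at most 1, so
    both components stay in the unit ball. This makes \<open>D\<close> compact, as a projection of a
    compact set.\<close>
  have norm1: "norm m \<le> 1 \<and> norm m1 \<le> 1" if "(m, m1) \<in> R" for m m1
  proof -
    have "0 \<le> blinfun_apply (m - m1) (linf_indicator UNIV)"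
      using that by (auto simp: R_def positive_invariant_def apply_linf_indicator)
    then show ?thesis using that
      by (auto simp: R_def blinfun.diff_left intro!: positive_invariant_norm)
  qed
  have R_iff: "(m, m1) \<in> R \<longleftrightarrow> norm m \<le> 1 \<and> norm m1 \<le> 1 \<and> (blinfun_apply m, blinfun_apply m1) \<in> Z" for m m1
    using norm1[of m m1] by (auto simp: R_def Z_def P_def positive_invariant_def blinfun.diff_left)
  define D where "D = fst ` R"
  let ?B = "blinfun_apply ` {m :: ('a \<Rightarrow>\<^sub>C real) \<Rightarrow>\<^sub>L real. norm m \<le> 1}"
  have "blinfun_apply ` D = fst ` ((?B \<times> ?B) \<inter> Z)"
  proof (intro equalityI subsetI)
    fix u assume "u \<in> blinfun_apply ` D"
    then obtain m m1 where "(m, m1) \<in> R" "u = blinfun_apply m" by (auto simp: D_def)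
    then show "u \<in> fst ` ((?B \<times> ?B) \<inter> Z)"
      by (intro image_eqI[where x = "(blinfun_apply m, blinfun_apply m1)"]) (auto simp: R_iff)
  next
    fix u assume "u \<in> fst ` ((?B \<times> ?B) \<inter> Z)"
    then obtain m m1 where "(m, m1) \<in> R" "u = blinfun_apply m" by (auto simp: R_iff)
    then show "u \<in> blinfun_apply ` D" by (force simp: D_def)
  qed
  moreover have "compact (fst ` ((?B \<times> ?B) \<inter> Z))"
    by (intro compact_continuous_image continuous_intros compact_Int_closed compact_Times
        Banach_Alaoglu \<open>closed Z\<close>)
  ultimately have "compact (blinfun_apply ` D)" by simp
  moreover have "convex D"
  proof -
    have "convex R" unfolding convex_alt
    proof (intro ballI allI impI)
      fix x y u assume xy: "x \<in> R" "y \<in> R" and u: "0 \<le> u \<and> u \<le> (1::real)"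
      obtain m m1 n n1 where mn: "x = (m, m1)" "y = (n, n1)" by fastforce
      have conv: "(1 - u) *\<^sub>R a + u *\<^sub>R b \<in> positive_invariant"
        if "a \<in> positive_invariant" "b \<in> positive_invariant" for a b :: "('a \<Rightarrow>\<^sub>C real) \<Rightarrow>\<^sub>L real"
        using that u by (intro convexD_alt[OF convex_positive_invariant]) auto
      have "((1 - u) *\<^sub>R m + u *\<^sub>R n) - ((1 - u) *\<^sub>R m1 + u *\<^sub>R n1) =
          (1 - u) *\<^sub>R (m - m1) + u *\<^sub>R (n - n1)" by (simp add: algebra_simps)
      then show "(1 - u) *\<^sub>R x + u *\<^sub>R y \<in> R"
        using xy u by (auto simp: R_def mn blinfun.add_left blinfun.scaleR_left
            intro!: conv add_mono mult_left_mono)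
    qed
    then show ?thesis unfolding D_def by (intro convex_linear_image linear_fst)
  qed
  moreover have "\<nu> \<in> D" if \<nu>: "\<nu> extreme_point_of invariant_means" for \<nu>
  proof -
    have inv: "\<nu> \<in> positive_invariant" "\<nu> (linf_indicator UNIV) = 1"
      using \<nu> by (auto simp: extreme_point_of_def invariant_means_iff)
    \<comment> \<open>If \<open>\<nu> p\<close> is not positive, the summand 0 already satisfies the
      inequality at \<open>p\<close>.\<close>
    have "(\<nu>, if 0 < \<nu> p then \<nu> else 0) \<in> R"
      using inv ext[OF \<nu>] by (auto simp: R_def positive_invariant_zero)
    then show ?thesis by (force simp: D_def)
  qed
  ultimately have "invariant_means \<subseteq> D"
    by (intro weak_star_Krein_Milman compact_invariant_means)
  then show ?thesis using m that by (force simp: D_def R_def)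
qed


section \<open>Almost invariant sets from dominated functionals\<close>

abbreviation bdd :: "('a \<Rightarrow> real) \<Rightarrow> bool" where
  "bdd f \<equiv> bounded (range f)"

lemma bdd_iff: "bdd f \<longleftrightarrow> (\<exists>M. \<forall>x. \<bar>f x\<bar> \<le> M)"
  by (auto simp: bounded_iff)

lemma bdd_add: "bdd f \<Longrightarrow> bdd g \<Longrightarrow> bdd (\<lambda>x. f x + g x)"
  by (rule bounded_plus_comp)

lemma bdd_diff: "bdd f \<Longrightarrow> bdd g \<Longrightarrow> bdd (\<lambda>x. f x - g x)"
  by (rule bounded_minus_comp)

lemma bdd_mult:
  assumes "bdd f" "bdd g"
  shows "bdd (\<lambda>x. f x * g x)"
proof -
  obtain M N where "\<And>x. \<bar>f x\<bar> \<le> M" "\<And>x. \<bar>g x\<bar> \<le> N" using assms by (auto simp: bdd_iff)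
  then have "\<bar>f x * g x\<bar> \<le> M * N" for x
    unfolding abs_mult by (meson abs_ge_zero mult_mono order_trans)
  then show ?thesis by (auto simp: bdd_iff)
qed

lemma bdd_const: "bdd (\<lambda>_. c)"
  by (auto simp: bdd_iff)

lemma bdd_indicator: "bdd (\<lambda>x. indicator C (h x))"
  unfolding bdd_iff by (intro exI[of _ 1]) (auto simp: indicator_def)

lemma bdd_sgn: "bdd (\<lambda>x. sgn (h x :: real))"
  unfolding bdd_iff by (intro exI[of _ 1]) (auto simp: sgn_if)

lemma bdd_shift:
  assumes "bdd f"
  shows "bdd (\<lambda>x. f (x + t))" "bdd (\<lambda>x. f (x - t))"
  using assms by (auto simp: bdd_iff)

lemma bdd_abs: "bdd f \<Longrightarrow> bdd (\<lambda>x. \<bar>f x\<bar>)"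
  by (auto simp: bdd_iff)

lemma bdd_max:
  assumes "bdd f"
  shows "bdd (\<lambda>x. max (c::real) (f x))"
proof -
  obtain M where M: "\<And>x. \<bar>f x\<bar> \<le> M" using assms by (auto simp: bdd_iff)
  have "\<bar>max c (f x)\<bar> \<le> \<bar>c\<bar> + M" for x using M[of x] by (auto simp: max_def)
  then show ?thesis by (auto simp: bdd_iff)
qed

lemma bdd_min:
  assumes "bdd f"
  shows "bdd (\<lambda>x. min (c::real) (f x))"
proof -
  obtain M where M: "\<And>x. \<bar>f x\<bar> \<le> M" using assms by (auto simp: bdd_iff)
  have "\<bar>min c (f x)\<bar> \<le> \<bar>c\<bar> + M" for x using M[of x] by (auto simp: min_def)
  then show ?thesis by (auto simp: bdd_iff)
qed

lemma bdd_sum: "(\<And>i. i \<in> S \<Longrightarrow> bdd (f i)) \<Longrightarrow> bdd (\<lambda>x. \<Sum>i\<in>S. f i x)"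
  by (induction S rule: infinite_finite_induct) (auto simp: bdd_const intro!: bdd_add)

lemma bdd_power2: "bdd f \<Longrightarrow> bdd (\<lambda>x. (f x)\<^sup>2)"
  unfolding power2_eq_square by (rule bdd_mult)

lemmas bdd_intros = bdd_add bdd_diff bdd_mult bdd_const bdd_indicator bdd_sgn bdd_shift bdd_abs
  bdd_max bdd_min bdd_sum bdd_power2

lemma bdd_le: "(\<And>x. \<bar>f x\<bar> \<le> M) \<Longrightarrow> bdd f"
  by (auto simp: bdd_iff)

text \<open>Integration against an invariant finitely additive measure of finite mass. It acts on
  plain functions and is constrained only on bounded ones, so that integrands can be manipulated as
  ordinary real functions; the mass is left free to admit a part of a mean.\<close>

locale invariant_functional =
  fixes \<mu> :: "('a::ab_group_add \<Rightarrow> real) \<Rightarrow> real"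
  assumes add: "bdd f \<Longrightarrow> bdd g \<Longrightarrow> \<mu> (\<lambda>x. f x + g x) = \<mu> f + \<mu> g"
    and scale: "bdd f \<Longrightarrow> \<mu> (\<lambda>x. c * f x) = c * \<mu> f"
    and nonneg: "bdd f \<Longrightarrow> (\<And>x. 0 \<le> f x) \<Longrightarrow> 0 \<le> \<mu> f"
    and shift: "bdd f \<Longrightarrow> \<mu> (\<lambda>x. f (x - t)) = \<mu> f"
begin

lemma diff: "bdd f \<Longrightarrow> bdd g \<Longrightarrow> \<mu> (\<lambda>x. f x - g x) = \<mu> f - \<mu> g"
  using add[of f "\<lambda>x. -1 * g x"] scale[of g "-1"] bdd_mult[OF bdd_const[of "-1"], of g] by simp

lemma mono: "bdd f \<Longrightarrow> bdd g \<Longrightarrow> (\<And>x. f x \<le> g x) \<Longrightarrow> \<mu> f \<le> \<mu> g"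
  using nonneg[of "\<lambda>x. g x - f x"] diff[of g f] bdd_diff[of g f] by simp

lemma zero: "\<mu> (\<lambda>_. 0) = 0"
  using scale[of "\<lambda>_. 0" 0] by (simp add: bdd_const)

lemma sum: "(\<And>i. i \<in> S \<Longrightarrow> bdd (f i)) \<Longrightarrow> \<mu> (\<lambda>x. \<Sum>i\<in>S. f i x) = (\<Sum>i\<in>S. \<mu> (f i))"
  by (induction S rule: infinite_finite_induct) (auto simp: zero add bdd_sum)

lemma abs_le: "(\<And>x. \<bar>f x\<bar> \<le> c) \<Longrightarrow> \<bar>\<mu> f\<bar> \<le> c * \<mu> (\<lambda>_. 1)"
proof -
  assume le: "\<And>x. \<bar>f x\<bar> \<le> c"
  then have f: "bdd f" by (rule bdd_le)
  have "\<mu> f \<le> \<mu> (\<lambda>x. c * 1)" "\<mu> (\<lambda>x. (- c) * 1) \<le> \<mu> f"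
    using le by (auto intro!: mono f bdd_const simp: abs_le_iff minus_le_iff)
  then show ?thesis
    using scale[OF bdd_const[of 1], of c] scale[OF bdd_const[of 1], of "- c"] by auto
qed

end

locale dominated_functional = \<mu>: invariant_functional \<mu> + \<mu>1: invariant_functional \<mu>1
  for \<mu> \<mu>1 :: "('a::ab_group_add \<Rightarrow> real) \<Rightarrow> real" +
  assumes dominated: "bdd f \<Longrightarrow> (\<And>x. 0 \<le> f x) \<Longrightarrow> \<mu>1 f \<le> \<mu> f"
    and total: "\<mu> (\<lambda>_. 1) = 1"
begin

text \<open>A finitely additive Radon--Nikodym theorem, up to an error: the density is an almost
  minimiser of \<open>\<mu> (f\<^sup>2) - 2 \<mu>1 f\<close>, which is \<open>\<mu> ((f - h)\<^sup>2)\<close> up to a constant if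
  \<open>h\<close> is an exact density of \<open>\<mu>1\<close>.\<close>

lemma approximate_density:
  assumes \<epsilon>: "\<epsilon> > 0"
  obtains f where "\<And>x. 0 \<le> f x" "\<And>x. f x \<le> 1"
    "\<And>g. (\<And>x. \<bar>g x\<bar> \<le> 1) \<Longrightarrow> \<bar>\<mu> (\<lambda>x. f x * g x) - \<mu>1 g\<bar> \<le> \<epsilon>"
proof -
  define Q where "Q f = \<mu> (\<lambda>x. (f x)\<^sup>2) - 2 * \<mu>1 f" for f
  define U where "U = {f :: 'a \<Rightarrow> real. \<forall>x. 0 \<le> f x \<and> f x \<le> 1}"
  \<comment> \<open>Truncation to values between 0 and 1 does not increase \<open>Q\<close>. Below 0
    both terms improve; above 1 the excess \<open>p\<close> costs at most
    \<open>2 * \<mu>1 p \<le> 2 * \<mu> p\<close>, which the inequality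
    \<open>2 * (f x - 1) \<le> (f x)\<^sup>2 - 1\<close> pays for. This is where domination bounds
    the density by 1.\<close>
  have clamp: "\<exists>c\<in>U. Q c \<le> Q f" if f: "bdd f" for f
  proof
    define c where "c x = max 0 (min 1 (f x))" for x
    define p where "p x = max 0 (f x - 1)" for x
    show "c \<in> U" by (auto simp: U_def c_def)
    have [simp]: "bdd c" "bdd p" unfolding c_def p_def by (intro bdd_intros f)+
    have "f x - c x \<le> p x" for x by (auto simp: c_def p_def)
    then have "\<mu>1 f - \<mu>1 c \<le> \<mu>1 p"
      using \<mu>1.mono[of "\<lambda>x. f x - c x" p] \<mu>1.diff[of f c] f by (simp add: bdd_diff)
    also have "\<dots> \<le> \<mu> p" by (intro dominated) (auto simp: p_def[abs_def] intro!: bdd_intros f)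
    finally have "2 * (\<mu>1 f - \<mu>1 c) \<le> 2 * \<mu> p" by simp
    also have "\<dots> = \<mu> (\<lambda>x. 2 * p x)" by (simp add: \<mu>.scale)
    also have "\<dots> \<le> \<mu> (\<lambda>x. (f x)\<^sup>2 - (c x)\<^sup>2)"
    proof (rule \<mu>.mono)
      fix x
      have "0 \<le> (f x - 1)\<^sup>2" by simp
      then have "2 * (f x - 1) \<le> (f x)\<^sup>2 - 1" by (simp add: power2_eq_square algebra_simps)
      then show "2 * p x \<le> (f x)\<^sup>2 - (c x)\<^sup>2" by (auto simp: p_def c_def max_def min_def)
    qed (intro bdd_intros f, simp_all)+
    also have "\<dots> = \<mu> (\<lambda>x. (f x)\<^sup>2) - \<mu> (\<lambda>x. (c x)\<^sup>2)"
      by (intro \<mu>.diff bdd_intros f) simp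
    finally show "Q c \<le> Q f" by (simp add: Q_def)
  qed
  have bdd_U: "bdd f" if "f \<in> U" for f
    using that by (intro bdd_le[of _ 1]) (auto simp: U_def)
  have lower: "- 2 \<le> Q f" if "f \<in> U" for f
  proof -
    have "\<mu>1 f \<le> \<mu> f" using that bdd_U by (intro dominated) (auto simp: U_def)
    also have "\<mu> f \<le> \<mu> (\<lambda>_. 1)" using that bdd_U
      by (intro \<mu>.mono bdd_const) (auto simp: U_def)
    finally have "\<mu>1 f \<le> 1" by (simp add: total)
    moreover have "0 \<le> \<mu> (\<lambda>x. (f x)\<^sup>2)" using that
      by (intro \<mu>.nonneg bdd_intros bdd_U) auto
    ultimately show ?thesis by (simp add: Q_def)
  qed
  have below: "bdd_below (Q ` U)" using lower by (intro bdd_belowI) auto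
  have "(\<lambda>_. 0) \<in> U" by (simp add: U_def)
  then have "Q ` U \<noteq> {}" by blast
  then obtain f where f: "f \<in> U" "Q f < Inf (Q ` U) + \<epsilon>\<^sup>2"
    using \<epsilon> cInf_lessD[of "Q ` U" "Inf (Q ` U) + \<epsilon>\<^sup>2"] by auto
  show ?thesis
  proof (rule that)
    show "0 \<le> f x" "f x \<le> 1" for x using f(1) by (auto simp: U_def)
    fix g :: "'a \<Rightarrow> real" assume g1: "\<And>x. \<bar>g x\<bar> \<le> 1"
    have g: "bdd g" by (rule bdd_le[OF g1])
    have bf: "bdd f" by (rule bdd_U[OF f(1)])
    define d where "d = \<mu> (\<lambda>x. f x * g x) - \<mu>1 g"
    \<comment> \<open>A step against \<open>g\<close> whose length is the defect \<open>d\<close>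
      itself lowers \<open>Q\<close> by at least \<open>d\<^sup>2\<close>, because
      \<open>g\<^sup>2\<close> has integral at most 1. As \<open>f\<close> minimises
      \<open>Q\<close> up to \<open>\<epsilon>\<^sup>2\<close>, the defect is at most
      \<open>\<epsilon>\<close>; \<open>clamp\<close> brings \<open>h\<close> back into
      \<open>U\<close> for the comparison.\<close>
    define h where "h x = f x + (- d) * g x" for x
    have "bdd h" unfolding h_def by (intro bdd_intros bf g)
    then obtain c where "c \<in> U" "Q c \<le> Q h" using clamp by blast
    then have "Inf (Q ` U) \<le> Q h" using below by (meson cINF_lower order_trans)
    moreover have "Q h = \<mu> (\<lambda>x. (f x)\<^sup>2 + (- 2 * d) * (f x * g x) + d\<^sup>2 * (g x)\<^sup>2)
        - 2 * \<mu>1 (\<lambda>x. f x + (- d) * g x)"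
      unfolding Q_def h_def
      by (rule arg_cong2[where f = "(-)"] arg_cong[where f = \<mu>] ext)+
        (simp_all add: power2_eq_square algebra_simps)
    then have "Q h = \<mu> (\<lambda>x. (f x)\<^sup>2) + (- 2 * d) * \<mu> (\<lambda>x. f x * g x) + d\<^sup>2 * \<mu> (\<lambda>x. (g x)\<^sup>2)
        - 2 * (\<mu>1 f + (- d) * \<mu>1 g)"
      using bf g by (simp only: \<mu>.add \<mu>.scale \<mu>1.add \<mu>1.scale bdd_intros)
    then have "Q h = Q f - 2 * d\<^sup>2 + d\<^sup>2 * \<mu> (\<lambda>x. (g x)\<^sup>2)"
      by (simp add: Q_def d_def power2_eq_square algebra_simps)
    moreover have "\<mu> (\<lambda>x. (g x)\<^sup>2) \<le> 1"
      using \<mu>.abs_le[of "\<lambda>x. (g x)\<^sup>2" 1] g1 by (simp add: total abs_square_le_1)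
    then have "d\<^sup>2 * \<mu> (\<lambda>x. (g x)\<^sup>2) \<le> d\<^sup>2 * 1" by (intro mult_left_mono) auto
    ultimately have "d\<^sup>2 \<le> \<epsilon>\<^sup>2" using f(2) by simp
    then show "\<bar>\<mu> (\<lambda>x. f x * g x) - \<mu>1 g\<bar> \<le> \<epsilon>"
      using \<epsilon> by (simp add: d_def abs_le_square_iff[symmetric])
  qed
qed

text \<open>A finite layer cake formula: the number of levels \<open>l < N\<close> with
  \<open>x \<in> C l\<close> is the integer part of \<open>N * f x\<close>. The thresholds start at
  \<open>1 / N\<close> and not at 0, so that this count is exact.\<close>

lemma level_sets:
  assumes \<epsilon>: "\<epsilon> > 0"
  obtains N :: nat and C :: "nat \<Rightarrow> 'a set" and f where "N > 0"
    "\<And>l. C l = {x. real (l + 1) / real N \<le> f x}"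
    "\<And>g. (\<And>x. \<bar>g x\<bar> \<le> 1) \<Longrightarrow>
       \<bar>(\<Sum>l<N. \<mu> (\<lambda>x. g x * indicator (C l) x)) - real N * \<mu>1 g\<bar> \<le> real N * \<epsilon>"
proof -
  obtain f where f: "\<And>x. 0 \<le> f x" "\<And>x. f x \<le> 1"
    "\<And>g. (\<And>x. \<bar>g x\<bar> \<le> 1) \<Longrightarrow> \<bar>\<mu> (\<lambda>x. f x * g x) - \<mu>1 g\<bar> \<le> \<epsilon> / 2"
    using approximate_density[of "\<epsilon> / 2"] \<epsilon> by auto
  \<comment> \<open>Half of \<open>\<epsilon>\<close> is spent on the density; this \<open>N\<close>
    makes the rounding error 1 at most \<open>N * (\<epsilon> / 2)\<close>.\<close>
  obtain N :: nat where N: "2 / \<epsilon> < N" using reals_Archimedean2 by blast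
  then have N0: "N > 0" using \<epsilon> by (metis divide_pos_pos less_trans of_nat_0_less_iff zero_less_numeral)
  define C where "C l = {x. real (l + 1) / real N \<le> f x}" for l
  have S: "\<bar>(\<Sum>l<N. indicator (C l) x) - real N * f x\<bar> \<le> 1" for x
  proof -
    define k where "k = nat \<lfloor>real N * f x\<rfloor>"
    have Nf: "0 \<le> real N * f x" "real N * f x \<le> N" using f(1,2)[of x] by (auto simp: mult_left_le)
    have k: "real k \<le> real N * f x" "real N * f x < real k + 1" "k \<le> N"
      using Nf by (auto simp: k_def) linarith+
    have "x \<in> C l \<longleftrightarrow> l < k" for l
    proof -
      have "x \<in> C l \<longleftrightarrow> real (l + 1) \<le> real N * f x"
        using N0 by (simp add: C_def pos_divide_le_eq mult.commute)
      also have "\<dots> \<longleftrightarrow> l < k" using k by (auto; linarith)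
      finally show ?thesis .
    qed
    then have "(\<Sum>l<N. indicator (C l) x) = (\<Sum>l<N. if l < k then 1 else (0::real))"
      by (intro sum.cong) (auto simp: indicator_def)
    also have "\<dots> = real (card {l. l < N \<and> l < k})"
      by (simp add: sum.If_cases Int_def)
    also have "{l. l < N \<and> l < k} = {..<k}" using k(3) by auto
    finally show ?thesis using k by simp
  qed
  show ?thesis
  proof (rule that[OF N0])
    show "C l = {x. real (l + 1) / real N \<le> f x}" for l by (rule C_def)
    fix g :: "'a \<Rightarrow> real" assume g1: "\<And>x. \<bar>g x\<bar> \<le> 1"
    have g: "bdd g" by (rule bdd_le[OF g1])
    have bf: "bdd f" using f by (intro bdd_le[of _ 1]) auto
    have "(\<Sum>l<N. \<mu> (\<lambda>x. g x * indicator (C l) x)) = \<mu> (\<lambda>x. \<Sum>l<N. g x * indicator (C l) x)"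
      by (intro \<mu>.sum[symmetric] bdd_intros g)
    moreover have "\<bar>\<mu> (\<lambda>x. (\<Sum>l<N. g x * indicator (C l) x) - real N * (f x * g x))\<bar> \<le> 1 * \<mu> (\<lambda>_. 1)"
    proof (rule \<mu>.abs_le)
      fix x
      have "(\<Sum>l<N. g x * indicator (C l) x) - real N * (f x * g x)
          = g x * ((\<Sum>l<N. indicator (C l) x) - real N * f x)"
        by (simp add: sum_distrib_left algebra_simps)
      also have "\<bar>\<dots>\<bar> \<le> 1 * 1" unfolding abs_mult using g1 S by (intro mult_mono) auto
      finally show "\<bar>(\<Sum>l<N. g x * indicator (C l) x) - real N * (f x * g x)\<bar> \<le> 1" by simp
    qed
    moreover have "\<mu> (\<lambda>x. (\<Sum>l<N. g x * indicator (C l) x) - real N * (f x * g x))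
        = \<mu> (\<lambda>x. \<Sum>l<N. g x * indicator (C l) x) - real N * \<mu> (\<lambda>x. f x * g x)"
      using bf g by (simp only: \<mu>.diff \<mu>.scale bdd_intros)
    moreover have "\<bar>real N * \<mu> (\<lambda>x. f x * g x) - real N * \<mu>1 g\<bar> \<le> real N * (\<epsilon> / 2)"
      using f(3)[OF g1] by (simp add: right_diff_distrib[symmetric] abs_mult mult_left_mono del: times_divide_eq_right)
    moreover have "1 \<le> real N * (\<epsilon> / 2)" using N \<epsilon> by (simp add: field_simps)
    moreover have "real N * \<epsilon> = real N * (\<epsilon> / 2) + real N * (\<epsilon> / 2)" by simp
    ultimately show "\<bar>(\<Sum>l<N. \<mu> (\<lambda>x. g x * indicator (C l) x)) - real N * \<mu>1 g\<bar> \<le> real N * \<epsilon>"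
      using total by linarith
  qed
qed

text \<open>All requirements must hold at one and the same level, so they are combined into a single
  quantity \<open>L\<close>, whose average over the levels is at least
  \<open>\<mu>1 \<phi> - \<eta>\<close>. At a level where \<open>L\<close> is not below that, the
  penalty divided by \<open>\<eta>\<close> is at most \<open>2 + \<eta> \<le> 3\<close>, since the
  integral of \<open>\<phi>\<close> over the level set is at most 2 and \<open>\<mu>1 \<phi>\<close>
  is nonnegative.\<close>

lemma almost_invariant_set:
  fixes \<phi> \<psi> :: "'a \<Rightarrow> real"
  assumes \<phi>: "\<And>x. \<bar>\<phi> x\<bar> \<le> 2" "0 \<le> \<mu>1 \<phi>"
    and \<psi>: "\<And>x. 0 \<le> \<psi> x" "\<And>x. \<psi> x \<le> 1" "\<mu>1 \<psi> = 0"
    and F: "finite F" and \<eta>: "0 < \<eta>" "\<eta> \<le> 1"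
  obtains C where "\<mu>1 \<phi> - \<eta> \<le> \<mu> (\<lambda>x. \<phi> x * indicator C x)"
    "\<mu> (\<lambda>x. \<psi> x * indicator C x) \<le> 3 * \<eta>"
    "\<And>t. t \<in> F \<Longrightarrow> \<mu> (\<lambda>x. \<bar>indicator C x - indicator C (x - t)\<bar>) \<le> 3 * \<eta>"
proof -
  \<comment> \<open>With this \<open>k\<close> the total error
    \<open>2 * \<epsilon> + (1 + 2 * card F) * \<epsilon> / \<eta>\<close> is
    \<open>\<epsilon> * k\<close>, which equals \<open>\<eta>\<close>.\<close>
  define k where "k = 2 + (1 + 2 * real (card F)) / \<eta>"
  have k: "k > 0" using \<eta> by (auto simp: k_def intro!: add_pos_nonneg)
  define \<epsilon> where "\<epsilon> = \<eta> / k"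
  have \<epsilon>: "\<epsilon> > 0" using \<eta> k by (simp add: \<epsilon>_def)
  obtain N :: nat and C and f where N: "N > 0"
    and C: "\<And>l. C l = {x. real (l + 1) / real N \<le> f x}"
    and avg: "\<And>g. (\<And>x. \<bar>g x\<bar> \<le> 1) \<Longrightarrow>
       \<bar>(\<Sum>l<N. \<mu> (\<lambda>x. g x * indicator (C l) x)) - real N * \<mu>1 g\<bar> \<le> real N * \<epsilon>"
    using level_sets[OF \<epsilon>] by blast
  have b\<phi>: "bdd \<phi>" using \<phi>(1) by (rule bdd_le)
  have b\<psi>: "bdd \<psi>" using \<psi> by (intro bdd_le[of _ 1]) auto
  define p where "p l = \<mu> (\<lambda>x. \<phi> x * indicator (C l) x)" for l
  define q where "q l = \<mu> (\<lambda>x. \<psi> x * indicator (C l) x)" for l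
  define D where "D t l = \<mu> (\<lambda>x. \<bar>indicator (C l) x - indicator (C l) (x - t)\<bar>)" for t l
  have nn: "0 \<le> q l" "0 \<le> D t l" for l t
    unfolding q_def D_def using \<psi>(1) by (auto intro!: \<mu>.nonneg bdd_intros b\<psi>)
  have sum_p: "real N * \<mu>1 \<phi> - 2 * (real N * \<epsilon>) \<le> (\<Sum>l<N. p l)"
  proof -
    \<comment> \<open>\<open>avg\<close> asks for a test function bounded by 1, hence the factor
      \<open>1/2\<close>.\<close>
    have "\<bar>(\<Sum>l<N. \<mu> (\<lambda>x. (1/2 * \<phi> x) * indicator (C l) x)) - real N * \<mu>1 (\<lambda>x. 1/2 * \<phi> x)\<bar> \<le> real N * \<epsilon>"
      using \<phi>(1) by (intro avg) (simp add: abs_mult)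
    moreover have "\<mu> (\<lambda>x. (1/2 * \<phi> x) * indicator (C l) x) = 1/2 * p l" for l
      unfolding p_def mult.assoc by (intro \<mu>.scale bdd_intros b\<phi>)
    moreover have "\<mu>1 (\<lambda>x. 1/2 * \<phi> x) = 1/2 * \<mu>1 \<phi>" by (intro \<mu>1.scale b\<phi>)
    ultimately show ?thesis by (simp only: sum_distrib_left[symmetric])
  qed
  have sum_q: "(\<Sum>l<N. q l) \<le> real N * \<epsilon>"
    using avg[of \<psi>] \<psi> by (simp add: q_def abs_le_iff)
  have sum_D: "(\<Sum>l<N. D t l) \<le> 2 * (real N * \<epsilon>)" for t
  proof -
    \<comment> \<open>All \<open>C l\<close> are level sets of the same \<open>f\<close>, so the
      difference of the indicators at \<open>x\<close> and \<open>x - t\<close> has the sign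
      \<open>\<sigma> x\<close> or vanishes, for all levels at once. This turns the absolute values
      into two linear averages, which nearly cancel because \<open>\<mu>1\<close> is
      invariant.\<close>
    define \<sigma> where "\<sigma> x = sgn (f x - f (x - t))" for x
    have b\<sigma>: "bdd \<sigma>" unfolding \<sigma>_def by (intro bdd_intros)
    have s1: "\<bar>\<sigma> x\<bar> \<le> 1" for x by (auto simp: \<sigma>_def sgn_if)
    have "D t l = \<mu> (\<lambda>x. \<sigma> x * indicator (C l) x) - \<mu> (\<lambda>x. \<sigma> (x + t) * indicator (C l) x)" for l
    proof -
      have "(\<lambda>x. \<bar>indicator (C l) x - indicator (C l) (x - t)\<bar>) =
          (\<lambda>x. \<sigma> x * indicator (C l) x - \<sigma> x * indicator (C l) (x - t) :: real)"
        by (auto simp: \<sigma>_def C indicator_def sgn_if)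
      then have "D t l = \<mu> (\<lambda>x. \<sigma> x * indicator (C l) x) - \<mu> (\<lambda>x. \<sigma> x * indicator (C l) (x - t))"
        using b\<sigma> by (simp only: D_def \<mu>.diff bdd_intros)
      moreover have "\<mu> (\<lambda>x. \<sigma> x * indicator (C l) (x - t)) = \<mu> (\<lambda>x. \<sigma> (x + t) * indicator (C l) x)"
        using \<mu>.shift[of "\<lambda>x. \<sigma> (x + t) * indicator (C l) x" t] b\<sigma> by (simp add: bdd_intros)
      ultimately show ?thesis by simp
    qed
    then have "(\<Sum>l<N. D t l) = (\<Sum>l<N. \<mu> (\<lambda>x. \<sigma> x * indicator (C l) x))
        - (\<Sum>l<N. \<mu> (\<lambda>x. \<sigma> (x + t) * indicator (C l) x))" by (simp add: sum_subtractf)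
    moreover have "\<mu>1 (\<lambda>x. \<sigma> (x + t)) = \<mu>1 \<sigma>"
      using \<mu>1.shift[of \<sigma> "- t"] b\<sigma> by simp
    ultimately show ?thesis using avg[of \<sigma>] avg[of "\<lambda>x. \<sigma> (x + t)"] s1 by (simp add: abs_le_iff)
  qed
  define L where "L l = p l - (q l + (\<Sum>t\<in>F. D t l)) / \<eta>" for l
  have "(\<Sum>l<N. q l + (\<Sum>t\<in>F. D t l)) \<le> real N * \<epsilon> + card F * (2 * (real N * \<epsilon>))"
  proof -
    have "(\<Sum>l<N. \<Sum>t\<in>F. D t l) = (\<Sum>t\<in>F. \<Sum>l<N. D t l)" by (rule sum.swap)
    also have "\<dots> \<le> card F * (2 * (real N * \<epsilon>))" by (rule sum_bounded_above[OF sum_D])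
    finally show ?thesis using sum_q by (simp add: sum.distrib)
  qed
  then have "(\<Sum>l<N. q l + (\<Sum>t\<in>F. D t l)) / \<eta> \<le> (real N * \<epsilon> + card F * (2 * (real N * \<epsilon>))) / \<eta>"
    using \<eta> by (intro divide_right_mono) auto
  then have "(\<Sum>l<N. L l) \<ge> real N * \<mu>1 \<phi> - 2 * (real N * \<epsilon>) - (real N * \<epsilon> + card F * (2 * (real N * \<epsilon>))) / \<eta>"
    using sum_p by (simp add: L_def sum_subtractf sum_divide_distrib[symmetric])
  also have "real N * \<mu>1 \<phi> - 2 * (real N * \<epsilon>) - (real N * \<epsilon> + card F * (2 * (real N * \<epsilon>))) / \<eta>
      = real N * (\<mu>1 \<phi> - \<epsilon> * k)"
    using \<eta> by (simp add: k_def field_simps)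
  also have "\<epsilon> * k = \<eta>" using k by (simp add: \<epsilon>_def)
  finally have sum_L: "real N * (\<mu>1 \<phi> - \<eta>) \<le> (\<Sum>l<N. L l)" .
  have "\<exists>l<N. \<mu>1 \<phi> - \<eta> \<le> L l"
  proof (rule ccontr)
    assume "\<not> ?thesis"
    then have "(\<Sum>l<N. L l) < (\<Sum>l<N. \<mu>1 \<phi> - \<eta>)"
      using N by (intro sum_strict_mono) auto
    then show False using sum_L by simp
  qed
  then obtain l where l: "\<mu>1 \<phi> - \<eta> \<le> L l" by blast
  have sD: "0 \<le> (\<Sum>t\<in>F. D t l)" using nn by (intro sum_nonneg) auto
  have "p l \<le> 2"
    using \<mu>.abs_le[of "\<lambda>x. \<phi> x * indicator (C l) x" 2] \<phi>(1)
    by (auto simp: p_def total abs_mult indicator_def abs_le_iff)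
  then have "(q l + (\<Sum>t\<in>F. D t l)) / \<eta> \<le> 3" using l \<phi>(2) \<eta> by (simp add: L_def)
  then have pen: "q l + (\<Sum>t\<in>F. D t l) \<le> 3 * \<eta>" using \<eta> by (simp add: field_simps)
  show ?thesis
  proof (rule that[of "C l"])
    have "0 \<le> (q l + (\<Sum>t\<in>F. D t l)) / \<eta>" using nn sD \<eta> by simp
    then show "\<mu>1 \<phi> - \<eta> \<le> \<mu> (\<lambda>x. \<phi> x * indicator (C l) x)" using l by (simp add: L_def p_def)
    show "\<mu> (\<lambda>x. \<psi> x * indicator (C l) x) \<le> 3 * \<eta>" using pen sD by (simp add: q_def)
    fix t assume "t \<in> F"
    then have "D t l \<le> (\<Sum>t\<in>F. D t l)" using F nn by (intro member_le_sum) auto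
    then show "\<mu> (\<lambda>x. \<bar>indicator (C l) x - indicator (C l) (x - t)\<bar>) \<le> 3 * \<eta>"
      using pen nn(1)[of l] by (simp add: D_def)
  qed
qed

end

section \<open>Functionals on the space of bounded functions as functionals on plain
  functions\<close>

lemma apply_Bcontfun:
  fixes g :: "'a::discrete_topology \<Rightarrow> real"
  assumes "bdd g"
  shows "apply_bcontfun (Bcontfun g) = g"
  using assms by (intro Bcontfun_inverse) (simp add: bcontfun_def)

lemma invariant_functional_of_blinfun:
  assumes m: "m \<in> positive_invariant"
  shows "invariant_functional (\<lambda>g. blinfun_apply m (Bcontfun g))"
proof
  fix f g :: "'a \<Rightarrow> real" and c :: real and t :: 'a
  assume f: "bdd f"
  have "Bcontfun (\<lambda>x. c * f x) = c *\<^sub>R Bcontfun f"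
    by (intro bcontfun_eqI) (simp add: apply_Bcontfun f bdd_intros)
  then show "m (Bcontfun (\<lambda>x. c * f x)) = c * m (Bcontfun f)"
    by (simp add: blinfun.scaleR_right)
  have "Bcontfun (\<lambda>x. f (x - t)) = translate t (Bcontfun f)"
    by (intro bcontfun_eqI) (simp add: apply_Bcontfun f bdd_intros apply_translate)
  then show "m (Bcontfun (\<lambda>x. f (x - t))) = m (Bcontfun f)"
    using m by (simp add: positive_invariant_def)
  show "0 \<le> m (Bcontfun f)" if "\<And>x. 0 \<le> f x"
    using m f that by (simp add: positive_invariant_def apply_Bcontfun)
  assume g: "bdd g"
  have "Bcontfun (\<lambda>x. f x + g x) = Bcontfun f + Bcontfun g"
    by (intro bcontfun_eqI) (simp add: apply_Bcontfun f g bdd_intros)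
  then show "m (Bcontfun (\<lambda>x. f x + g x)) = m (Bcontfun f) + m (Bcontfun g)"
    by (simp add: blinfun.add_right)
qed

section \<open>Transversals of a finite index subgroup\<close>

lemma is_subgroup_diff: "is_subgroup K \<Longrightarrow> x \<in> K \<Longrightarrow> y \<in> K \<Longrightarrow> x - y \<in> K"
  unfolding is_subgroup_def diff_conv_add_uminus[of x y] by blast

lemma transversal_exists:
  assumes K: "is_subgroup K" and fin: "finite_index K"
  obtains R where "finite R" "card R = group_index K" "\<And>x. \<exists>!r. r \<in> R \<and> x - r \<in> K"
proof -
  define rep where "rep C = (SOME r. r \<in> C)" for C :: "'a set"
  have mem: "x \<in> g +o K \<longleftrightarrow> x - g \<in> K" for x g
  proof
    assume "x - g \<in> K"
    then have "g + (x - g) \<in> g +o K" by (rule set_plus_intro2)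
    then show "x \<in> g +o K" by simp
  qed (auto simp: elt_set_plus_def)
  have rep: "rep (g +o K) - g \<in> K" for g
  proof -
    have "g \<in> g +o K" using K by (simp add: mem is_subgroup_def)
    then have "rep (g +o K) \<in> g +o K" unfolding rep_def by (rule someI)
    then show ?thesis by (simp add: mem)
  qed
  have coset_eq: "g +o K = h +o K" if "g - h \<in> K" for g h
  proof -
    have "x - g \<in> K \<longleftrightarrow> x - h \<in> K" for x
    proof
      assume "x - g \<in> K"
      then have "(x - g) + (g - h) \<in> K" using that K unfolding is_subgroup_def by blast
      then show "x - h \<in> K" by simp
    next
      assume "x - h \<in> K"
      then have "(x - h) - (g - h) \<in> K" by (rule is_subgroup_diff[OF K _ that])
      then show "x - g \<in> K" by simp
    qed
    then show ?thesis by (auto simp: mem set_eq_iff)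
  qed
  have uniq: "r = s" if rs: "r \<in> rep ` cosets K" "s \<in> rep ` cosets K" and diff: "r - s \<in> K" for r s
  proof -
    obtain g h where gh: "r = rep (g +o K)" "s = rep (h +o K)" using rs unfolding cosets_def by blast
    have "(r - g) - (r - s) - (s - h) \<in> K"
      using is_subgroup_diff[OF K is_subgroup_diff[OF K rep[of g] diff[unfolded gh]] rep[of h]]
      by (simp only: gh)
    then have "h - g \<in> K" by (simp add: algebra_simps)
    then show ?thesis using coset_eq[of h g] gh by simp
  qed
  show ?thesis
  proof (rule that)
    show "finite (rep ` cosets K)" using fin by (simp add: finite_index_def)
    have "inj_on rep (cosets K)"
    proof (rule inj_onI)
      fix C D assume "C \<in> cosets K" "D \<in> cosets K" and eq: "rep C = rep D"
      then obtain g h where gh: "C = g +o K" "D = h +o K" by (auto simp: cosets_def)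
      have "(rep D - h) - (rep C - g) \<in> K"
        unfolding gh by (rule is_subgroup_diff[OF K rep rep])
      then have "g - h \<in> K" using eq by simp
      then show "C = D" using gh by (simp add: coset_eq)
    qed
    then show "card (rep ` cosets K) = group_index K" by (simp add: card_image group_index_def)
    fix x
    have "0 - (rep (x +o K) - x) \<in> K"
      using K by (intro is_subgroup_diff[OF K _ rep]) (simp add: is_subgroup_def)
    then have "x - rep (x +o K) \<in> K" by simp
    moreover have "r = s" if "r \<in> rep ` cosets K" "s \<in> rep ` cosets K" "x - r \<in> K" "x - s \<in> K" for r s
    proof (rule uniq[OF that(1,2)])
      have "(x - s) - (x - r) \<in> K" by (rule is_subgroup_diff[OF K that(4,3)])
      then show "r - s \<in> K" by simp
    qed
    moreover have "rep (x +o K) \<in> rep ` cosets K" by (auto simp: cosets_def)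
    ultimately show "\<exists>!r. r \<in> rep ` cosets K \<and> x - r \<in> K" by blast
  qed
qed

lemma sum_indicator_transversal:
  assumes "finite R" "\<And>x. \<exists>!r. r \<in> R \<and> x - r \<in> K"
  shows "(\<Sum>r\<in>R. indicator K (x - r)) = (1::real)"
proof -
  obtain r where r: "r \<in> R" "x - r \<in> K" "\<And>s. s \<in> R \<Longrightarrow> x - s \<in> K \<Longrightarrow> s = r"
    using assms(2)[of x] by blast
  have "(\<Sum>s\<in>R. indicator K (x - s)) = (\<Sum>s\<in>R. if s = r then 1 else (0::real))"
    using r(2) by (intro sum.cong) (auto simp: indicator_def dest: r(3))
  then show ?thesis using assms(1) r(1) by simp
qed

text \<open>\<open>S + K\<close> is the disjoint union of the cosets of \<open>K\<close> through the
  points of \<open>R \<inter> (S + K)\<close>, and the translates of each such coset by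
  \<open>R\<close> tile the group. So the sum does not depend on \<open>x\<close>.\<close>

lemma sum_indicator_periodic:
  assumes R: "finite R" "\<And>x. \<exists>!r. r \<in> R \<and> x - r \<in> K" and K: "is_subgroup K"
  shows "(\<Sum>r\<in>R. indicator (S + K) (x - r)) = real (card (R \<inter> (S + K)))"
proof -
  have per: "y + k \<in> S + K" if y: "y \<in> S + K" and k: "k \<in> K" for y k
  proof -
    obtain s l where "s \<in> S" "l \<in> K" "y = s + l" using y by (rule set_plus_elim)
    then have "y + k = s + (l + k)" "l + k \<in> K" using k K by (auto simp: is_subgroup_def add.assoc)
    then show ?thesis using set_plus_intro[OF \<open>s \<in> S\<close>, of "l + k" K] by (simp add: add.assoc)
  qed
  have "indicator (S + K) y = (\<Sum>s\<in>R \<inter> (S + K). indicator K (y - s) :: real)" for y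
  proof (cases "y \<in> S + K")
    case True
    have "s \<in> S + K" if "y - s \<in> K" for s
    proof -
      have "0 - (y - s) \<in> K" using K by (intro is_subgroup_diff[OF K _ that]) (simp add: is_subgroup_def)
      from per[OF True this] show ?thesis by simp
    qed
    then have "(\<Sum>s\<in>R \<inter> (S + K). indicator K (y - s) :: real) = (\<Sum>s\<in>R. indicator K (y - s))"
      using R(1) by (intro sum.mono_neutral_left) (auto simp: indicator_def)
    then show ?thesis using True sum_indicator_transversal[OF R] by simp
  next
    case False
    have "y - s \<notin> K" if "s \<in> S + K" for s using per[of s "y - s"] False that by auto
    then show ?thesis using False by (auto simp: indicator_def)
  qed
  then have "(\<Sum>r\<in>R. indicator (S + K) (x - r)) =
      (\<Sum>r\<in>R. \<Sum>s\<in>R \<inter> (S + K). indicator K (x - r - s) :: real)"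
    by simp
  also have "\<dots> = (\<Sum>s\<in>R \<inter> (S + K). \<Sum>r\<in>R. indicator K (x - r - s))" by (rule sum.swap)
  also have "\<dots> = (\<Sum>s\<in>R \<inter> (S + K). \<Sum>r\<in>R. indicator K (x - s - r))"
    by (intro sum.cong refl arg_cong[where f = "indicator K"]) (simp add: algebra_simps)
  finally show ?thesis by (simp add: sum_indicator_transversal[OF R])
qed

context dominated_functional
begin

text \<open>The translates of \<open>h\<close> by \<open>R\<close> add up to a constant
  \<open>c\<close>. Applying \<open>\<mu>1\<close>, \<open>c\<close> times the mass is
  \<open>k * \<mu>1 h\<close>, which by \<open>rel\<close> is \<open>k\<close> times the value on
  \<open>K\<close>, which is the mass; so \<open>c = 1\<close>. Integrated over \<open>C\<close>,
  this identity writes the size of \<open>C\<close> as a sum of \<open>k\<close> integrals, each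
  nearly \<open>\<delta>\<close> or more, since \<open>\<phi> - \<psi>\<close> is pointwise at most
  \<open>h\<close>.\<close>

lemma realizing_set:
  fixes A B K :: "'a set"
  defines "\<phi> \<equiv> \<lambda>x. indicator A x + indicator B x - indicator (A + B) x"
    and "\<psi> \<equiv> \<lambda>x. indicator (A + B + K) x - indicator (A + B) x"
  assumes K: "is_subgroup K" "finite_index K"
    and \<psi>: "\<mu>1 \<psi> = 0"
    and rel: "\<mu>1 (\<lambda>x. indicator (A + K) x + indicator (B + K) x - indicator (A + B + K) x - indicator K x) = 0"
    and \<delta>: "0 < \<delta>" "\<delta> \<le> \<mu>1 \<phi>" and F: "finite F" and \<epsilon>: "0 < \<epsilon>"
  obtains C where "real (group_index K) * \<delta> - \<epsilon> \<le> \<mu> (indicator C)"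
    "\<delta> - \<epsilon> \<le> \<mu> (\<lambda>x. \<phi> x * indicator C x)"
    "\<mu> (\<lambda>x. \<psi> x * indicator C x) \<le> \<epsilon>"
    "\<And>t. t \<in> F \<Longrightarrow> \<mu> (\<lambda>x. \<bar>indicator C x - indicator C (x - t)\<bar>) \<le> \<epsilon>"
proof -
  define k where "k = group_index K"
  obtain R where R: "finite R" "card R = k" "\<And>x. \<exists>!r. r \<in> R \<and> x - r \<in> K"
    using transversal_exists[OF K] unfolding k_def by blast
  have "R \<noteq> {}" using R(3)[of 0] by blast
  then have k: "real k \<ge> 1" using R(1,2) by (simp add: Suc_le_eq card_gt_0_iff flip: R(2))
  define h :: "'a \<Rightarrow> real" where
    "h x = indicator (A + K) x + indicator (B + K) x - indicator (A + B + K) x" for x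
  define c where "c = real (card (R \<inter> (A + K))) + real (card (R \<inter> (B + K))) - real (card (R \<inter> (A + B + K)))"
  have bh: "bdd h" unfolding h_def by (intro bdd_intros)
  have h2: "\<bar>h x\<bar> \<le> 2" for x by (auto simp: h_def indicator_def)
  have sum_h: "(\<Sum>r\<in>R. h (x - r)) = c" for x
    by (simp add: h_def sum.distrib sum_subtractf sum_indicator_periodic[OF R(1,3) K(1)] c_def)
  have bind: "bdd (indicator S :: 'a \<Rightarrow> real)" for S by (rule bdd_indicator)
  \<comment> \<open>Since \<open>\<phi>\<close> is at most 2, positivity of
    \<open>\<mu>1 \<phi>\<close> forces positive mass, which is cancelled when \<open>c\<close> is
    determined.\<close>
  have "\<phi> x \<le> 2 * 1" for x by (auto simp: \<phi>_def indicator_def)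
  then have "\<mu>1 \<phi> \<le> \<mu>1 (\<lambda>_. 2 * 1)" by (intro \<mu>1.mono) (auto simp: \<phi>_def intro!: bdd_intros)
  then have pos1: "0 < \<mu>1 (\<lambda>_. 1)" using \<delta> \<mu>1.scale[of "\<lambda>_. 1" 2] by (simp add: bdd_const)
  have "\<mu>1 (\<lambda>x. \<Sum>r\<in>R. h (x - r)) = (\<Sum>r\<in>R. \<mu>1 (\<lambda>x. h (x - r)))"
    by (intro \<mu>1.sum bdd_intros bh)
  then have "\<mu>1 (\<lambda>x. c * 1) = real k * \<mu>1 h" using R(2) by (simp add: sum_h \<mu>1.shift bh)
  then have c1: "c * \<mu>1 (\<lambda>_. 1) = real k * \<mu>1 h" by (simp only: \<mu>1.scale bdd_const)
  have "\<mu>1 (\<lambda>x. \<Sum>r\<in>R. indicator K (x - r)) = (\<Sum>r\<in>R. \<mu>1 (\<lambda>x. indicator K (x - r)))"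
    by (intro \<mu>1.sum bdd_intros)
  then have "\<mu>1 (\<lambda>_. 1) = real k * \<mu>1 (indicator K)"
    using R(2) by (simp add: sum_indicator_transversal[OF R(1,3)] \<mu>1.shift bind)
  moreover have "\<mu>1 h = \<mu>1 (indicator K)"
    using rel \<mu>1.diff[OF bh bind[of K]] by (simp add: h_def)
  ultimately have "c * \<mu>1 (\<lambda>_. 1) = 1 * \<mu>1 (\<lambda>_. 1)" using c1 by (simp only: mult_1)
  then have c: "c = 1" using pos1 by simp
  \<comment> \<open>The loss per translate is \<open>10 * \<eta>\<close>: one \<open>\<eta>\<close>
    from \<open>\<phi>\<close>, three from \<open>\<psi>\<close> and six from the translation. There
    are \<open>k\<close> translates.\<close>
  define \<eta> where "\<eta> = min 1 (\<epsilon> / (10 * real k))"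
  have \<eta>: "0 < \<eta>" "\<eta> \<le> 1" using \<epsilon> k by (auto simp: \<eta>_def)
  have "\<eta> \<le> \<epsilon> / (10 * real k)" by (simp add: \<eta>_def)
  then have \<eta>k: "10 * real k * \<eta> \<le> \<epsilon>" using k by (simp add: pos_le_divide_eq mult.commute)
  have "1 * \<eta> \<le> real k * \<eta>" using k \<eta> by (intro mult_right_mono) auto
  then have \<eta>10: "10 * \<eta> \<le> \<epsilon>" using \<eta>k by simp
  have "S \<subseteq> S + K" for S
    using set_plus_intro[of _ S 0 K] K(1) by (auto simp: is_subgroup_def)
  then have sub: "A \<subseteq> A + K" "B \<subseteq> B + K" "A + B \<subseteq> A + B + K" by blast+
  \<comment> \<open>The negatives of \<open>R\<close> are tested too, because moving the translate
    of \<open>h\<close> by \<open>r\<close> back onto \<open>h\<close> moves \<open>C\<close> by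
    \<open>- r\<close>.\<close>
  obtain C where C: "\<mu>1 \<phi> - \<eta> \<le> \<mu> (\<lambda>x. \<phi> x * indicator C x)"
    "\<mu> (\<lambda>x. \<psi> x * indicator C x) \<le> 3 * \<eta>"
    "\<And>t. t \<in> F \<union> uminus ` R \<Longrightarrow> \<mu> (\<lambda>x. \<bar>indicator C x - indicator C (x - t)\<bar>) \<le> 3 * \<eta>"
  proof (rule almost_invariant_set[of \<phi> \<psi> "F \<union> uminus ` R" \<eta>])
    show "\<bar>\<phi> x\<bar> \<le> 2" for x by (auto simp: \<phi>_def indicator_def)
    show "0 \<le> \<psi> x" "\<psi> x \<le> 1" for x using sub by (auto simp: \<psi>_def indicator_def)
  qed (use \<delta> \<psi> F R \<eta> in auto)
  have b\<phi>: "bdd \<phi>" and b\<psi>: "bdd \<psi>" unfolding \<phi>_def \<psi>_def by (intro bdd_intros)+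
  have \<mu>h: "\<delta> - 4 * \<eta> \<le> \<mu> (\<lambda>x. h x * indicator C x)"
  proof -
    have "\<mu> (\<lambda>x. \<phi> x * indicator C x - \<psi> x * indicator C x) \<le> \<mu> (\<lambda>x. h x * indicator C x)"
      using sub by (intro \<mu>.mono bdd_intros bh b\<phi> b\<psi>) (auto simp: h_def \<phi>_def \<psi>_def indicator_def)
    then show ?thesis using C(1,2) \<delta> b\<phi> b\<psi> by (simp add: \<mu>.diff bdd_intros)
  qed
  have step: "\<mu> (\<lambda>x. h x * indicator C x) - 6 * \<eta> \<le> \<mu> (\<lambda>x. h (x - r) * indicator C x)" if r: "r \<in> R" for r
  proof -
    have "\<mu> (\<lambda>x. h (x - r) * indicator C x) = \<mu> (\<lambda>x. h x * indicator C (x - (- r)))"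
      using \<mu>.shift[of "\<lambda>x. h x * indicator C (x + r)" r] by (simp add: bdd_intros bh)
    moreover have "\<mu> (\<lambda>x. h x * indicator C x - 2 * \<bar>indicator C x - indicator C (x - (- r))\<bar>)
        \<le> \<mu> (\<lambda>x. h x * indicator C (x - (- r)))"
    proof (rule \<mu>.mono)
      fix x show "h x * indicator C x - 2 * \<bar>indicator C x - indicator C (x - - r)\<bar>
          \<le> h x * indicator C (x - - r)"
        using h2[of x] by (auto simp: indicator_def abs_le_iff)
    qed (intro bdd_intros bh)+
    moreover have "\<mu> (\<lambda>x. h x * indicator C x - 2 * \<bar>indicator C x - indicator C (x - (- r))\<bar>)
        = \<mu> (\<lambda>x. h x * indicator C x) - 2 * \<mu> (\<lambda>x. \<bar>indicator C x - indicator C (x - (- r))\<bar>)"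
      using bh by (simp only: \<mu>.diff \<mu>.scale bdd_intros)
    moreover have "\<mu> (\<lambda>x. \<bar>indicator C x - indicator C (x - (- r))\<bar>) \<le> 3 * \<eta>"
      using r by (intro C(3)) auto
    ultimately show ?thesis by linarith
  qed
  show ?thesis
  proof (rule that[of C])
    have "indicator C x = (\<Sum>r\<in>R. h (x - r) * indicator C x)" for x
      using sum_h[of x] c by (simp add: sum_distrib_right[symmetric])
    then have "\<mu> (indicator C) = \<mu> (\<lambda>x. \<Sum>r\<in>R. h (x - r) * indicator C x)" by presburger
    also have "\<dots> = (\<Sum>r\<in>R. \<mu> (\<lambda>x. h (x - r) * indicator C x))"
      by (intro \<mu>.sum bdd_intros bh)
    also have "\<dots> \<ge> (\<Sum>r\<in>R. \<delta> - 10 * \<eta>)" using \<mu>h step by (intro sum_mono) force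
    finally have "real k * (\<delta> - 10 * \<eta>) \<le> \<mu> (indicator C)" using R(2) by simp
    then show "real (group_index K) * \<delta> - \<epsilon> \<le> \<mu> (indicator C)"
      using \<eta>k by (simp add: k_def algebra_simps)
    show "\<delta> - \<epsilon> \<le> \<mu> (\<lambda>x. \<phi> x * indicator C x)" using C(1) \<delta> \<eta> \<eta>10 by linarith
    show "\<mu> (\<lambda>x. \<psi> x * indicator C x) \<le> \<epsilon>" using C(2) \<eta> \<eta>10 by linarith
    show "\<mu> (\<lambda>x. \<bar>indicator C x - indicator C (x - t)\<bar>) \<le> \<epsilon>" if "t \<in> F" for t
      using C(3)[of t] that \<eta> \<eta>10 by simp
  qed
qed

end


section \<open>Nets and limits of averages\<close>

lemma tail_nonempty: "directed_set I le \<Longrightarrow> i \<in> I \<Longrightarrow> {j\<in>I. le i j} \<noteq> {}"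
  unfolding directed_set_def by blast

lemma eventually_in_net:
  assumes "directed_set I le"
  shows "eventually (\<lambda>i. i \<in> I) (net_filter I le)"
  unfolding eventually_net_filter[OF assms] using assms unfolding directed_set_def by blast

lemma eventually_above:
  assumes "directed_set I le" "i \<in> I"
  shows "eventually (le i) (net_filter I le)"
  unfolding eventually_net_filter[OF assms(1)] using assms(2) by blast

lemma net_filter_nat: "net_filter UNIV ((\<le>) :: nat \<Rightarrow> nat \<Rightarrow> bool) = sequentially"
proof (rule filter_eqI)
  fix P :: "nat \<Rightarrow> bool"
  have "directed_set UNIV ((\<le>) :: nat \<Rightarrow> nat \<Rightarrow> bool)"
    unfolding directed_set_def by (blast intro: order_trans max.cobounded1 max.cobounded2)
  then show "eventually P (net_filter UNIV (\<le>)) \<longleftrightarrow> eventually P sequentially"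
    by (simp add: eventually_net_filter eventually_sequentially)
qed

context
  fixes I :: "'i set" and le x and M :: real
  assumes dir: "directed_set I le" and bdd_x: "\<And>i. i \<in> I \<Longrightarrow> \<bar>x i\<bar> \<le> M"
begin

private definition tail_inf :: "'i \<Rightarrow> real" where "tail_inf i = (INF j\<in>{j\<in>I. le i j}. x j)"

private lemma tail_inf_lower: "j \<in> I \<Longrightarrow> le i j \<Longrightarrow> tail_inf i \<le> x j"
  unfolding tail_inf_def using bdd_x
  by (intro cINF_lower bdd_belowI[where m = "- M"]) (auto simp: abs_le_iff minus_le_iff)

private lemma tail_inf_greatest:
  "i \<in> I \<Longrightarrow> (\<And>j. j \<in> I \<Longrightarrow> le i j \<Longrightarrow> c \<le> x j) \<Longrightarrow> c \<le> tail_inf i"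
  unfolding tail_inf_def using tail_nonempty[OF dir] by (intro cINF_greatest) auto

private lemma tail_inf_bdd_above: "bdd_above (tail_inf ` I)"
proof (rule bdd_aboveI2)
  fix i assume i: "i \<in> I"
  then obtain j where "j \<in> I" "le i j" using tail_nonempty[OF dir] by blast
  then show "tail_inf i \<le> M" using tail_inf_lower[of j i] bdd_x[of j] by linarith
qed

text \<open>The tail infima increase by transitivity of the relation and are bounded, so they
  converge to their supremum.\<close>

private lemma tail_inf_tendsto: "(tail_inf \<longlongrightarrow> (SUP i\<in>I. tail_inf i)) (net_filter I le)"
proof (rule order_tendstoI)
  fix a assume "a < (SUP i\<in>I. tail_inf i)"
  moreover have "I \<noteq> {}" using dir by (simp add: directed_set_def)
  ultimately obtain i where i: "i \<in> I" "a < tail_inf i"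
    using tail_inf_bdd_above by (auto simp: less_cSUP_iff)
  have "a < tail_inf j" if "j \<in> I" "le i j" for j
  proof -
    have "tail_inf i \<le> tail_inf j"
    proof (rule tail_inf_greatest[OF that(1)])
      fix k assume "k \<in> I" "le j k"
      then show "tail_inf i \<le> x k"
        using that i(1) dir unfolding directed_set_def by (intro tail_inf_lower) blast+
    qed
    then show ?thesis using i by simp
  qed
  then show "eventually (\<lambda>j. a < tail_inf j) (net_filter I le)"
    using i by (auto simp: eventually_net_filter[OF dir])
next
  fix a assume a: "(SUP i\<in>I. tail_inf i) < a"
  show "eventually (\<lambda>j. tail_inf j < a) (net_filter I le)"
    using eventually_in_net[OF dir]
    by eventually_elim (use a cSUP_upper[OF _ tail_inf_bdd_above] in force)
qed

private lemma net_liminf_eq: "net_liminf I le x = (SUP i\<in>I. tail_inf i)"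
  using tendsto_Lim[OF net_filter_neq_bot[OF dir] tail_inf_tendsto]
  by (simp add: net_liminf_def tail_inf_def[abs_def])

lemma eventually_gt_net_liminf:
  assumes "c < net_liminf I le x"
  shows "eventually (\<lambda>i. c < x i) (net_filter I le)"
proof -
  have "eventually (\<lambda>i. c < tail_inf i) (net_filter I le)"
    using assms tail_inf_tendsto by (simp add: net_liminf_eq order_tendsto_iff)
  then obtain i where "i \<in> I" "\<And>j. j \<in> I \<Longrightarrow> le i j \<Longrightarrow> c < tail_inf j"
    by (auto simp: eventually_net_filter[OF dir])
  \<comment> \<open>The relation may be irreflexive, so the bound need not hold at \<open>i\<close>
    itself; an index above \<open>i\<close> serves instead.\<close>
  moreover obtain k where "k \<in> I" "le i k" using tail_nonempty[OF dir \<open>i \<in> I\<close>] by blast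
  ultimately have "c < tail_inf k" "k \<in> I" by auto
  then show ?thesis unfolding eventually_net_filter[OF dir] using tail_inf_lower by force
qed

text \<open>A net comes near its limit inferior from above only along a cofinal part, which is why
  limits of averages are later taken along a filter that forces such a property.\<close>

lemma frequently_lt_net_liminf:
  assumes "net_liminf I le x < c"
  shows "frequently (\<lambda>i. x i < c) (net_filter I le)"
proof (rule ccontr)
  assume "\<not> ?thesis"
  then obtain i where i: "i \<in> I" "\<And>j. j \<in> I \<Longrightarrow> le i j \<Longrightarrow> c \<le> x j"
    by (auto simp: frequently_def eventually_net_filter[OF dir] not_less)
  then have "c \<le> tail_inf i" by (intro tail_inf_greatest) auto
  also have "\<dots> \<le> net_liminf I le x" unfolding net_liminf_eq
    by (intro cSUP_upper tail_inf_bdd_above i)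
  finally show False using assms by simp
qed

lemma net_liminf_ge:
  assumes "\<And>e. 0 < e \<Longrightarrow> eventually (\<lambda>i. c - e \<le> x i) (net_filter I le)"
  shows "c \<le> net_liminf I le x"
proof (rule field_le_epsilon)
  fix e :: real assume "0 < e"
  then obtain i where i: "i \<in> I" "\<And>j. j \<in> I \<Longrightarrow> le i j \<Longrightarrow> c - e \<le> x j"
    using assms[of e] by (auto simp: eventually_net_filter[OF dir])
  then have "c - e \<le> tail_inf i" by (intro tail_inf_greatest) auto
  also have "\<dots> \<le> net_liminf I le x" unfolding net_liminf_eq
    by (intro cSUP_upper tail_inf_bdd_above i)
  finally show "c \<le> net_liminf I le x + e" by simp
qed

end

text \<open>Far out, a whole tail lies close to \<open>l\<close>; this makes the tail bounded and
  traps its infimum and supremum.\<close>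

lemma net_liminf_limsup_eq:
  assumes dir: "directed_set I le" and lim: "(x \<longlongrightarrow> l) (net_filter I le)"
  shows "net_liminf I le x = l" "net_limsup I le x = l"
proof -
  have tails: "eventually (\<lambda>i. \<forall>j\<in>{j\<in>I. le i j}. \<bar>x j - l\<bar> < e) (net_filter I le)" if e: "0 < e" for e
  proof -
    obtain i where i: "i \<in> I" "\<And>j. j \<in> I \<Longrightarrow> le i j \<Longrightarrow> \<bar>x j - l\<bar> < e"
      using tendstoD[OF lim e] by (auto simp: eventually_net_filter[OF dir] dist_real_def)
    then show ?thesis using dir unfolding eventually_net_filter[OF dir] directed_set_def by blast
  qed
  have bound: "\<bar>Inf (x ` S) - l\<bar> \<le> e" "\<bar>Sup (x ` S) - l\<bar> \<le> e"
    if ne: "S \<noteq> {}" and close: "\<forall>j\<in>S. \<bar>x j - l\<bar> < e" for S e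
  proof -
    have *: "l - e \<le> x j" "x j \<le> l + e" if "j \<in> S" for j
      using bspec[OF close that] by linarith+
    have bdds: "bdd_below (x ` S)" "bdd_above (x ` S)"
      using * by (auto intro!: bdd_belowI[where m = "l - e"] bdd_aboveI[where M = "l + e"])
    obtain j where j: "j \<in> S" using ne by blast
    have "Inf (x ` S) \<le> x j" "x j \<le> Sup (x ` S)"
      using bdds j by (auto intro: cINF_lower cSUP_upper)
    moreover have "l - e \<le> Inf (x ` S)" by (rule cINF_greatest[OF ne *(1)])
    moreover have "Sup (x ` S) \<le> l + e" by (rule cSUP_least[OF ne *(2)])
    ultimately show "\<bar>Inf (x ` S) - l\<bar> \<le> e" "\<bar>Sup (x ` S) - l\<bar> \<le> e"
      using *[OF j] by linarith+
  qed
  have half: "eventually (\<lambda>i. dist (INF j\<in>{j\<in>I. le i j}. x j) l < e \<and>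
      dist (SUP j\<in>{j\<in>I. le i j}. x j) l < e) (net_filter I le)" if e: "0 < e" for e
    using tails[OF half_gt_zero[OF e]] eventually_in_net[OF dir]
  proof eventually_elim
    case (elim i)
    from bound[OF tail_nonempty[OF dir elim(2)] elim(1)] e show ?case
      unfolding dist_real_def by linarith
  qed
  have "((\<lambda>i. INF j\<in>{j\<in>I. le i j}. x j) \<longlongrightarrow> l) (net_filter I le)"
    "((\<lambda>i. SUP j\<in>{j\<in>I. le i j}. x j) \<longlongrightarrow> l) (net_filter I le)"
    by (rule tendstoI, rule eventually_mono[OF half], assumption, erule conjunct1 conjunct2)+
  then show "net_liminf I le x = l" "net_limsup I le x = l"
    unfolding net_liminf_def net_limsup_def
    by (auto intro!: tendsto_Lim net_filter_neq_bot[OF dir])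
qed

section \<open>Averages over finite sets and their limits\<close>

definition average :: "'a set \<Rightarrow> ('a \<Rightarrow> real) \<Rightarrow> real" where
  "average X f = sum f X / real (card X)"

lemma average_indicator: "finite X \<Longrightarrow> average X (indicator C) = real (card (C \<inter> X)) / real (card X)"
  by (simp add: average_def indicator_def sum.If_cases Int_commute)

lemma abs_sum_diff_le:
  assumes "finite X" "finite Y" "\<And>x. \<bar>f x\<bar> \<le> (M::real)"
  shows "\<bar>sum f X - sum f Y\<bar> \<le> M * real (card (sym_diff X Y))"
proof -
  have "sum f X = sum f (X - Y) + sum f (X \<inter> Y)" "sum f Y = sum f (Y - X) + sum f (X \<inter> Y)"
    using assms(1,2) by (auto simp: sum.Int_Diff[of X f Y] sum.Int_Diff[of Y f X] Int_commute)
  moreover have "\<bar>sum f (X - Y)\<bar> \<le> real (card (X - Y)) * M" "\<bar>sum f (Y - X)\<bar> \<le> real (card (Y - X)) * M"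
    using assms(3) by (auto intro!: order_trans[OF sum_abs] sum_bounded_above)
  moreover have "card (sym_diff X Y) = card (X - Y) + card (Y - X)"
    using assms(1,2) by (intro card_Un_disjoint) auto
  ultimately show ?thesis by (simp add: algebra_simps)
qed

text \<open>Averaging the translate of \<open>f\<close> over \<open>X\<close> is averaging
  \<open>f\<close> over \<open>X\<close> moved by \<open>- t\<close>, and only the symmetric
  difference contributes to the change.\<close>

lemma abs_average_translate_le:
  fixes f :: "'a::ab_group_add \<Rightarrow> real"
  assumes "finite X" "\<And>x. \<bar>f x\<bar> \<le> M"
  shows "\<bar>average X (\<lambda>x. f (x - t)) - average X f\<bar>
    \<le> M * (real (card (sym_diff X ((\<lambda>x. x + - t) ` X))) / real (card X))"
proof -
  have "sum f ((\<lambda>x. x + - t) ` X) = (\<Sum>x\<in>X. f (x - t))"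
    by (subst sum.reindex) (auto simp: inj_on_def)
  then have "\<bar>(\<Sum>x\<in>X. f (x - t)) - sum f X\<bar> \<le> M * real (card (sym_diff X ((\<lambda>x. x + - t) ` X)))"
    using abs_sum_diff_le[of X "(\<lambda>x. x + - t) ` X" f M] assms by (simp add: abs_minus_commute)
  then show ?thesis
    by (simp add: average_def diff_divide_distrib[symmetric] abs_divide divide_right_mono)
qed

text \<open>The averages lie in the weak* compact unit ball and therefore cluster along the indices
  with \<open>P\<close>; the Folner condition makes the cluster point invariant. The filter
  \<open>G\<close> plays the role of a subnet, along which the averages of all \<open>f\<close>
  converge at once, without a new index type.\<close>

lemma invariant_mean_limit:
  fixes \<Phi> :: "'i \<Rightarrow> 'a::{ab_group_add, discrete_topology} set"
  assumes fol: "folner_net I le \<Phi>" and freq: "frequently P (net_filter I le)"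
  obtains m G where "m \<in> invariant_means" "G \<noteq> bot" "G \<le> net_filter I le" "eventually P G"
    "\<And>f. ((\<lambda>i. average (\<Phi> i) (apply_bcontfun f)) \<longlongrightarrow> blinfun_apply m f) G"
proof -
  have dir: "directed_set I le" and \<Phi>: "\<And>i. i \<in> I \<Longrightarrow> finite (\<Phi> i) \<and> \<Phi> i \<noteq> {}"
    using fol by (auto simp: folner_net_def)
  define a where "a i f = average (\<Phi> i) (apply_bcontfun f)" for i and f :: "'a \<Rightarrow>\<^sub>C real"
  define B where "B = blinfun_apply ` {m :: ('a \<Rightarrow>\<^sub>C real) \<Rightarrow>\<^sub>L real. norm m \<le> 1}"
  have aB: "a i \<in> B" if i: "i \<in> I" for i
  proof -
    have le: "\<bar>a i f\<bar> \<le> norm f" for f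
    proof -
      have "\<bar>sum (apply_bcontfun f) (\<Phi> i)\<bar> \<le> real (card (\<Phi> i)) * norm f"
        using norm_bounded[of f] by (intro order_trans[OF sum_abs] sum_bounded_above) auto
      then show ?thesis using \<Phi>[OF i]
        by (simp add: a_def average_def divide_le_eq mult.commute card_gt_0_iff)
    qed
    have "bounded_linear (a i)"
      using le by (intro bounded_linear_intro[where K = 1])
        (auto simp: a_def average_def sum.distrib add_divide_distrib sum_distrib_left)
    then have "blinfun_apply (Blinfun (a i)) = a i" by (rule bounded_linear_Blinfun_apply)
    moreover from this have "norm (Blinfun (a i)) \<le> 1"
      using le by (intro norm_blinfun_bound) auto
    ultimately show ?thesis unfolding B_def by (intro image_eqI[where x = "Blinfun (a i)"]) auto
  qed
  define F where "F = inf (net_filter I le) (principal {i. P i})"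
  have ev_F: "eventually Q F \<longleftrightarrow> eventually (\<lambda>i. P i \<longrightarrow> Q i) (net_filter I le)" for Q
    by (simp add: F_def eventually_inf_principal)
  have "\<not> eventually (\<lambda>_. False) F"
    using freq unfolding ev_F frequently_def by simp
  then have "filtermap a F \<noteq> bot" by (simp only: trivial_limit_def eventually_filtermap not_False_eq_True)
  moreover have "eventually (\<lambda>i. a i \<in> B) F"
    unfolding ev_F using eventually_in_net[OF dir] by eventually_elim (simp add: aB)
  then have "eventually (\<lambda>u. u \<in> B) (filtermap a F)" by (simp add: eventually_filtermap)
  moreover have "compact B" unfolding B_def by (rule Banach_Alaoglu)
  ultimately obtain u where u: "u \<in> B" "inf (nhds u) (filtermap a F) \<noteq> bot"
    unfolding compact_filter by blast
  obtain m where m: "u = blinfun_apply m" using u by (auto simp: B_def)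
  \<comment> \<open>Pulling back the neighbourhoods of \<open>u\<close> makes the averages converge
    to it; the resulting filter is proper because \<open>u\<close> is a cluster point.\<close>
  define G where "G = inf F (filtercomap a (nhds u))"
  have "G \<noteq> bot"
  proof
    assume "G = bot"
    then have "eventually (\<lambda>_. False) G" by simp
    then obtain Q R where QR: "eventually Q F" "eventually R (filtercomap a (nhds u))" "\<And>i. Q i \<Longrightarrow> \<not> R i"
      unfolding G_def eventually_inf by auto
    then obtain R' where R': "eventually R' (nhds u)" "\<And>i. R' (a i) \<Longrightarrow> R i"
      by (auto simp: eventually_filtercomap)
    have "eventually (\<lambda>v. \<not> R' v) (filtermap a F)"
      unfolding eventually_filtermap using QR(1) by eventually_elim (use QR(3) R'(2) in blast)
    then have "eventually (\<lambda>_. False) (inf (nhds u) (filtermap a F))"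
      unfolding eventually_inf using R'(1) by blast
    then show False using u(2) by (simp add: trivial_limit_def)
  qed
  have GF: "G \<le> F" by (simp add: G_def)
  have GN: "G \<le> net_filter I le" using GF by (simp add: F_def)
  have "filterlim a (nhds u) G"
    unfolding G_def by (intro filterlim_inf filterlim_mono[OF filterlim_filtercomap]) auto
  have lim: "((\<lambda>i. a i f) \<longlongrightarrow> m f) G" for f
    using continuous_on_tendsto_compose[OF continuous_on_product_coordinates[of f] \<open>filterlim a (nhds u) G\<close>]
    by (simp add: m)
  have inG: "eventually (\<lambda>i. i \<in> I) G" using eventually_in_net[OF dir] GN by (rule filter_leD[rotated])
  have "m \<in> invariant_means"
    unfolding invariant_means_iff positive_invariant_def mem_Collect_eq
  proof (intro conjI allI impI)
    show "0 \<le> m f" if f: "\<forall>x. 0 \<le> apply_bcontfun f x" for f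
      by (rule tendsto_lowerbound[OF lim _ \<open>G \<noteq> bot\<close>])
        (auto simp: a_def average_def f intro!: always_eventually sum_nonneg divide_nonneg_nonneg)
    have "eventually (\<lambda>i. a i (linf_indicator UNIV) = 1) G"
      using inG by eventually_elim (use \<Phi> in \<open>simp add: a_def average_def apply_linf_indicator\<close>)
    then have "((\<lambda>i. a i (linf_indicator UNIV)) \<longlongrightarrow> 1) G" by (rule tendsto_eventually)
    then show "m (linf_indicator UNIV) = 1" using lim tendsto_unique[OF \<open>G \<noteq> bot\<close>] by blast
    fix t f
    have ratio: "((\<lambda>i. real (card (sym_diff (\<Phi> i) ((\<lambda>x. x + - t) ` \<Phi> i))) / real (card (\<Phi> i)))
        \<longlongrightarrow> 0) G"
      using fol unfolding folner_net_def by (intro tendsto_mono[OF GN]) blast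
    have "((\<lambda>i. a i (translate t f) - a i f) \<longlongrightarrow> 0) G"
    proof (rule Lim_null_comparison)
      show "((\<lambda>i. norm f * (real (card (sym_diff (\<Phi> i) ((\<lambda>x. x + - t) ` \<Phi> i))) / real (card (\<Phi> i))))
        \<longlongrightarrow> 0) G" using tendsto_mult_right_zero[OF ratio] by simp
      show "eventually (\<lambda>i. norm (a i (translate t f) - a i f) \<le>
          norm f * (real (card (sym_diff (\<Phi> i) ((\<lambda>x. x + - t) ` \<Phi> i))) / real (card (\<Phi> i)))) G"
        using inG
      proof eventually_elim
        case (elim i)
        show ?case
          using abs_average_translate_le[of "\<Phi> i" "apply_bcontfun f" "norm f" t] \<Phi>[OF elim] norm_bounded[of f]
          by (simp add: a_def apply_translate[abs_def])
      qed
    qed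
    moreover have "((\<lambda>i. a i (translate t f) - a i f) \<longlongrightarrow> m (translate t f) - m f) G"
      by (intro tendsto_diff lim)
    ultimately show "m (translate t f) = m f" using tendsto_unique[OF \<open>G \<noteq> bot\<close>] by fastforce
  qed
  moreover have "eventually P G"
    using filter_leD[OF GF] by (simp add: ev_F)
  ultimately show ?thesis using that \<open>G \<noteq> bot\<close> GN lim unfolding a_def by blast
qed


section \<open>Approximating subsets and their limits\<close>

text \<open>All requirements on a subset \<open>Y\<close> of \<open>X\<close> at one stage, under a
  common tolerance: relative size \<open>r\<close>, invariance tested on \<open>F\<close>,
  prescribed densities. \<open>D\<close> is a set of pairs, so it can be empty while the densities
  are still unknown.\<close>

definition approximant ::
    "('a::ab_group_add set \<times> real) set \<Rightarrow> real \<Rightarrow> 'a set \<Rightarrow> real \<Rightarrow> 'a set \<Rightarrow> 'a set \<Rightarrow> bool" where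
  "approximant D r F \<epsilon> X Y \<longleftrightarrow> Y \<subseteq> X \<and> Y \<noteq> {} \<and>
     (r - \<epsilon>) * real (card X) \<le> real (card Y) \<and>
     (\<forall>t\<in>F. real (card (sym_diff Y ((\<lambda>x. x + t) ` Y))) \<le> \<epsilon> * real (card Y)) \<and>
     (\<forall>(S, d)\<in>D. \<bar>real (card (S \<inter> Y)) / real (card Y) - d\<bar> \<le> \<epsilon>)"

lemma approximant_mono:
  assumes "approximant D r F \<epsilon> X Y" "F' \<subseteq> F" "\<epsilon> \<le> \<epsilon>'"
  shows "approximant D r F' \<epsilon>' X Y"
proof -
  have "(r - \<epsilon>') * real (card X) \<le> (r - \<epsilon>) * real (card X)" "\<epsilon> * real (card Y) \<le> \<epsilon>' * real (card Y)"
    using assms(3) by (auto intro: mult_right_mono)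
  note le = this
  show ?thesis
    unfolding approximant_def
  proof (intro conjI ballI)
    show "Y \<subseteq> X" "Y \<noteq> {}" using assms(1) by (simp_all add: approximant_def)
    show "(r - \<epsilon>') * real (card X) \<le> real (card Y)"
      using assms(1) by (intro order_trans[OF le(1)]) (simp add: approximant_def)
    show "real (card (sym_diff Y ((\<lambda>x. x + t) ` Y))) \<le> \<epsilon>' * real (card Y)" if "t \<in> F'" for t
      using assms(1,2) that by (intro order_trans[OF _ le(2)]) (auto simp: approximant_def)
    show "case p of (S, d) \<Rightarrow> \<bar>real (card (S \<inter> Y)) / real (card Y) - d\<bar> \<le> \<epsilon>'" if "p \<in> D" for p
      using assms(1) that by (auto simp: approximant_def intro: order_trans[OF _ assms(3)])
  qed
qed

text \<open>Shared by nets and sequences: it is enough that the tolerances tend to 0 and that every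
  translation is eventually tested.\<close>

lemma approximants_limit:
  fixes \<Psi> \<Phi> :: "'j \<Rightarrow> 'a::ab_group_add set"
  assumes dir: "directed_set J le" and fin: "\<And>j. j \<in> J \<Longrightarrow> finite (\<Phi> j)"
    and approx: "\<And>j. j \<in> J \<Longrightarrow> approximant D r (F j) (e j) (\<Phi> j) (\<Psi> j)"
    and e: "(e \<longlongrightarrow> 0) (net_filter J le)"
    and F: "\<And>t. eventually (\<lambda>j. t \<in> F j) (net_filter J le)"
  shows "folner_net J le \<Psi>"
    "r \<le> net_liminf J le (\<lambda>j. real (card (\<Psi> j)) / real (card (\<Phi> j)))"
    "\<And>S d. (S, d) \<in> D \<Longrightarrow> has_density J le \<Psi> S d"
proof -
  note inJ = eventually_in_net[OF dir]
  have \<Psi>: "\<Psi> j \<subseteq> \<Phi> j" "\<Psi> j \<noteq> {}" "finite (\<Psi> j)" "0 < card (\<Psi> j)" "0 < card (\<Phi> j)"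
    "card (\<Psi> j) \<le> card (\<Phi> j)" if "j \<in> J" for j
  proof -
    show *: "\<Psi> j \<subseteq> \<Phi> j" "\<Psi> j \<noteq> {}" using approx[OF that] by (auto simp: approximant_def)
    show "finite (\<Psi> j)" by (rule finite_subset[OF *(1) fin[OF that]])
    then show "0 < card (\<Psi> j)" using * by (simp add: card_gt_0_iff)
    show le: "card (\<Psi> j) \<le> card (\<Phi> j)" by (rule card_mono[OF fin[OF that] *(1)])
    with \<open>0 < card (\<Psi> j)\<close> show "0 < card (\<Phi> j)" by simp
  qed
  show "folner_net J le \<Psi>" unfolding folner_net_def
  proof (intro conjI ballI allI)
    fix t
    have "eventually (\<lambda>j. norm (real (card (sym_diff (\<Psi> j) ((\<lambda>x. x + t) ` \<Psi> j))) / real (card (\<Psi> j)))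
        \<le> e j) (net_filter J le)"
      using inJ F[of t]
    proof eventually_elim
      case (elim j)
      then have "real (card (sym_diff (\<Psi> j) ((\<lambda>x. x + t) ` \<Psi> j))) \<le> e j * real (card (\<Psi> j))"
        using approx[of j] by (simp only: approximant_def)
      then show ?case using \<Psi>(4)[OF elim(1)] by (simp add: pos_divide_le_eq)
    qed
    then show "((\<lambda>j. real (card (sym_diff (\<Psi> j) ((\<lambda>x. x + t) ` \<Psi> j))) / real (card (\<Psi> j)))
        \<longlongrightarrow> 0) (net_filter J le)" using e by (rule Lim_null_comparison)
  qed (use dir \<Psi> in auto)
  show "r \<le> net_liminf J le (\<lambda>j. real (card (\<Psi> j)) / real (card (\<Phi> j)))"
  proof (rule net_liminf_ge[OF dir, where M = 1])
    show "\<bar>real (card (\<Psi> j)) / real (card (\<Phi> j))\<bar> \<le> 1" if "j \<in> J" for j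
      using \<Psi>(5,6)[OF that] by (simp add: divide_le_eq)
    fix d :: real assume "0 < d"
    then have "eventually (\<lambda>j. e j < d) (net_filter J le)" using e by (simp add: order_tendsto_iff)
    then show "eventually (\<lambda>j. r - d \<le> real (card (\<Psi> j)) / real (card (\<Phi> j))) (net_filter J le)"
      using inJ
    proof eventually_elim
      case (elim j)
      then have "r - e j \<le> real (card (\<Psi> j)) / real (card (\<Phi> j))"
        using approx[of j] \<Psi>(5)[of j] by (simp add: approximant_def pos_le_divide_eq)
      then show ?case using elim by simp
    qed
  qed
  fix S d assume SD: "(S, d) \<in> D"
  have "eventually (\<lambda>j. norm (real (card (S \<inter> \<Psi> j)) / real (card (\<Psi> j)) - d) \<le> e j) (net_filter J le)"
    using inJ
  proof eventually_elim
    case (elim j)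
    have "\<forall>(S, d)\<in>D. \<bar>real (card (S \<inter> \<Psi> j)) / real (card (\<Psi> j)) - d\<bar> \<le> e j"
      using approx[OF elim] unfolding approximant_def by (elim conjE)
    from bspec[OF this SD] show ?case by simp
  qed
  then have "((\<lambda>j. real (card (S \<inter> \<Psi> j)) / real (card (\<Psi> j)) - d) \<longlongrightarrow> 0) (net_filter J le)"
    using e by (rule Lim_null_comparison)
  then have "((\<lambda>j. real (card (S \<inter> \<Psi> j)) / real (card (\<Psi> j))) \<longlongrightarrow> d) (net_filter J le)"
    by (rule LIM_zero_cancel)
  then show "has_density J le \<Psi> S d"
    using net_liminf_limsup_eq[OF dir] by (simp add: has_density_def lower_density_def upper_density_def)
qed

text \<open>An index is a position \<open>i\<close> with a demand \<open>(F, n)\<close> that some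
  subset of \<open>\<Phi> i\<close> meets. The subnet map is the first projection, monotone by the
  choice of \<open>le'\<close>.\<close>

lemma subnet_from_approximants:
  fixes \<Phi> :: "'i \<Rightarrow> 'a::ab_group_add set"
  assumes dir: "directed_set I le" and fin: "\<And>i. i \<in> I \<Longrightarrow> finite (\<Phi> i)"
    and ex: "\<And>i0 F \<epsilon>. i0 \<in> I \<Longrightarrow> finite F \<Longrightarrow> 0 < \<epsilon> \<Longrightarrow>
      \<exists>i\<in>I. le i0 i \<and> (\<exists>Y. approximant D r F \<epsilon> (\<Phi> i) Y)"
  obtains J :: "('i \<times> 'a set \<times> nat) set" and le' h \<Psi> where
    "subnet_map I le J le' h" "folner_net J le' \<Psi>" "\<And>j. j \<in> J \<Longrightarrow> \<Psi> j \<subseteq> \<Phi> (h j)"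
    "r \<le> net_liminf J le' (\<lambda>j. real (card (\<Psi> j)) / real (card (\<Phi> (h j))))"
    "\<And>S d. (S, d) \<in> D \<Longrightarrow> has_density J le' \<Psi> S d"
proof -
  define J where "J = {(i, F, n :: nat). i \<in> I \<and> finite F \<and> (\<exists>Y. approximant D r F (1 / (real n + 1)) (\<Phi> i) Y)}"
  define le' where "le' = (\<lambda>(i, F :: 'a set, n :: nat) (j, G, m). le i j \<and> F \<subseteq> G \<and> n \<le> m)"
  define \<Psi> where "\<Psi> = (\<lambda>(i, F, n :: nat). SOME Y. approximant D r F (1 / (real n + 1)) (\<Phi> i) Y)"
  have trans: "le i k" if "i \<in> I" "j \<in> I" "k \<in> I" "le i j" "le j k" for i j k
    using dir that unfolding directed_set_def by blast
  \<comment> \<open>The triple \<open>(i0, F, n)\<close> itself need not lie in \<open>J\<close>;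
    \<open>ex\<close> moves the position upwards until the demand is met. Directedness and
    cofinality both rest on this.\<close>
  have upper: "\<exists>j\<in>J. le i0 (fst j) \<and> F \<subseteq> fst (snd j) \<and> n \<le> snd (snd j)"
    if i0: "i0 \<in> I" and F: "finite F" for i0 F n
  proof -
    have "(0::real) < 1 / (real n + 1)" by simp
    then obtain i where "i \<in> I" "le i0 i" "\<exists>Y. approximant D r F (1 / (real n + 1)) (\<Phi> i) Y"
      using ex[OF i0 F] by blast
    then show ?thesis using F by (intro bexI[of _ "(i, F, n)"]) (auto simp: J_def)
  qed
  have dirJ: "directed_set J le'"
    unfolding directed_set_def
  proof (intro conjI ballI impI)
    obtain i0 where "i0 \<in> I" using dir unfolding directed_set_def by blast
    then show "J \<noteq> {}" using upper[of i0 "{}" 0] by blast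
    show "le' x z" if "x \<in> J" "y \<in> J" "z \<in> J" "le' x y" "le' y z" for x y z
    proof -
      have "fst x \<in> I" "fst y \<in> I" "fst z \<in> I" "le (fst x) (fst y)" "le (fst y) (fst z)"
        using that by (auto simp: J_def le'_def)
      then have "le (fst x) (fst z)" by (rule trans)
      then show ?thesis using that(4,5) by (auto simp: le'_def split: prod.splits)
    qed
    fix x y assume xy: "x \<in> J" "y \<in> J"
    obtain i F n where x: "x = (i, F, n)" by (cases x)
    obtain j G m where y: "y = (j, G, m)" by (cases y)
    have I: "i \<in> I" "j \<in> I" "finite (F \<union> G)" using xy by (auto simp: x y J_def)
    then obtain k where k: "k \<in> I" "le i k" "le j k" using dir unfolding directed_set_def by blast
    obtain z where z: "z \<in> J" "le k (fst z)" "F \<union> G \<subseteq> fst (snd z)" "max n m \<le> snd (snd z)"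
      using upper[OF k(1) I(3), of "max n m"] by blast
    have "fst z \<in> I" using z(1) by (auto simp: J_def)
    then have "le i (fst z)" "le j (fst z)" using trans I k z(2) by blast+
    then show "\<exists>z\<in>J. le' x z \<and> le' y z"
      using z by (intro bexI[of _ z]) (auto simp: le'_def x y split: prod.splits)
  qed
  have approx: "approximant D r (fst (snd j)) (1 / (real (snd (snd j)) + 1)) (\<Phi> (fst j)) (\<Psi> j)" if "j \<in> J" for j
  proof -
    obtain i F n where j: "j = (i, F, n)" by (cases j)
    then have "\<exists>Y. approximant D r F (1 / (real n + 1)) (\<Phi> i) Y" using \<open>j \<in> J\<close> by (simp add: J_def)
    then show ?thesis unfolding j \<Psi>_def fst_conv snd_conv prod.case by (rule someI_ex)
  qed
  have sub: "subnet_map I le J le' fst"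
    unfolding subnet_map_def
  proof (intro conjI ballI impI)
    show "fst ` J \<subseteq> I" by (auto simp: J_def)
    show "le (fst j) (fst j')" if "le' j j'" for j j'
      using that by (simp add: le'_def split: prod.splits)
    show "\<exists>j\<in>J. le i0 (fst j)" if "i0 \<in> I" for i0 using upper[OF that finite.emptyI, of 0] by blast
  qed (rule dirJ)
  have above: "eventually (\<lambda>j. F \<subseteq> fst (snd j) \<and> n \<le> snd (snd j)) (net_filter J le')" if F: "finite F" for F n
  proof -
    obtain i0 where "i0 \<in> I" using dir unfolding directed_set_def by blast
    then obtain j where j: "j \<in> J" "F \<subseteq> fst (snd j)" "n \<le> snd (snd j)" using upper[OF _ F] by blast
    show ?thesis using eventually_above[OF dirJ j(1)]
      by eventually_elim (use j in \<open>auto simp: le'_def split: prod.splits\<close>)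
  qed
  have e: "((\<lambda>j. 1 / (real (snd (snd j)) + 1)) \<longlongrightarrow> 0) (net_filter J le')"
  proof (rule tendstoI)
    fix d :: real assume d: "0 < d"
    obtain n :: nat where n: "1 / d < real n" using reals_Archimedean2 by blast
    show "eventually (\<lambda>j. dist (1 / (real (snd (snd j)) + 1)) 0 < d) (net_filter J le')"
      using above[of "{}" n]
    proof (rule eventually_mono)
      fix j :: "'i \<times> 'a set \<times> nat" assume "{} \<subseteq> fst (snd j) \<and> n \<le> snd (snd j)"
      then have "1 / d < real (snd (snd j)) + 1" using n by linarith
      then show "dist (1 / (real (snd (snd j)) + 1)) 0 < d" using d by (simp add: field_simps)
    qed simp
  qed
  have F: "eventually (\<lambda>j. t \<in> fst (snd j)) (net_filter J le')" for t
    using above[of "{t}" 0] by (auto elim: eventually_mono)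
  have finJ: "finite (\<Phi> (fst j))" if "j \<in> J" for j using that fin by (auto simp: J_def)
  note lim = approximants_limit[where \<Phi> = "\<lambda>j. \<Phi> (fst j)", OF dirJ finJ approx e F]
  show ?thesis
  proof (rule that[OF sub lim(1)])
    show "\<Psi> j \<subseteq> \<Phi> (fst j)" if "j \<in> J" for j using approx[OF that] by (simp add: approximant_def)
  qed (use lim in auto)
qed

text \<open>If \<open>t\<close> is not a difference of two elements of any \<open>\<Phi> n\<close>,
  then each \<open>\<Phi> n\<close> is disjoint from its translate by \<open>t\<close> and the
  Folner ratio stays at least 1. So the group is a countable union of finite difference
  sets.\<close>

lemma folner_sequence_countable:
  fixes \<Phi> :: "nat \<Rightarrow> 'a::ab_group_add set"
  assumes fol: "folner_sequence \<Phi>"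
  shows "countable (UNIV :: 'a set)"
proof -
  define D where "D = (\<Union>n. (\<lambda>(x, y). x - y) ` (\<Phi> n \<times> \<Phi> n))"
  have fin: "finite (\<Phi> n)" "\<Phi> n \<noteq> {}" for n using fol by (auto simp: folner_net_def)
  have "t \<in> D" for t
  proof (rule ccontr)
    assume t: "t \<notin> D"
    have "real (card (sym_diff (\<Phi> n) ((\<lambda>x. x + t) ` \<Phi> n))) / real (card (\<Phi> n)) \<ge> 1" for n
    proof -
      have "x + t \<notin> \<Phi> n" if x: "x \<in> \<Phi> n" for x
      proof
        assume "x + t \<in> \<Phi> n"
        then have "(\<lambda>(x, y). x - y) (x + t, x) \<in> D" using x unfolding D_def by blast
        then show False using t by simp
      qed
      then have "\<Phi> n \<subseteq> sym_diff (\<Phi> n) ((\<lambda>x. x + t) ` \<Phi> n)" by auto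
      then have "card (\<Phi> n) \<le> card (sym_diff (\<Phi> n) ((\<lambda>x. x + t) ` \<Phi> n))"
        using fin by (intro card_mono) auto
      then show ?thesis using fin by (simp add: le_divide_eq card_gt_0_iff)
    qed
    moreover have "((\<lambda>n. real (card (sym_diff (\<Phi> n) ((\<lambda>x. x + t) ` \<Phi> n))) / real (card (\<Phi> n)))
        \<longlongrightarrow> 0) sequentially"
      using fol unfolding folner_net_def net_filter_nat by blast
    ultimately have "(1::real) \<le> 0" by (intro tendsto_lowerbound) auto
    then show False by simp
  qed
  moreover have "countable D" unfolding D_def using fin by (intro countable_UN countable_image) (auto intro: countable_finite)
  ultimately show ?thesis by (metis UNIV_eq_I)
qed

text \<open>A countable group is exhausted by increasing finite sets \<open>F j\<close>, so one
  demand for each \<open>j\<close> suffices, and positions can be chosen strictly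
  increasing.\<close>

lemma subsequence_from_approximants:
  fixes \<Phi> :: "nat \<Rightarrow> 'a::ab_group_add set"
  assumes count: "countable (UNIV :: 'a set)" and fin: "\<And>i. finite (\<Phi> i)"
    and ex: "\<And>i0 F \<epsilon>. finite F \<Longrightarrow> 0 < \<epsilon> \<Longrightarrow> \<exists>i\<ge>i0. \<exists>Y. approximant D r F \<epsilon> (\<Phi> i) Y"
  obtains n :: "nat \<Rightarrow> nat" and \<Psi> where
    "strict_mono n" "folner_sequence \<Psi>" "\<And>j. \<Psi> j \<subseteq> \<Phi> (n j)"
    "r \<le> net_liminf UNIV (\<le>) (\<lambda>j. real (card (\<Psi> j)) / real (card (\<Phi> (n j))))"
    "\<And>S d. (S, d) \<in> D \<Longrightarrow> has_density UNIV (\<le>) \<Psi> S d"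
proof -
  \<comment> \<open>In a finite group the enumeration takes a default value beyond its range; what
    counts is that \<open>t\<close> belongs to \<open>F j\<close> from its own index on.\<close>
  define F where "F j = from_nat_into (UNIV :: 'a set) ` {..j :: nat}" for j
  define ok where "ok j i \<longleftrightarrow> (\<exists>Y. approximant D r (F j) (1 / (real j + 1)) (\<Phi> i) Y)" for j i
  have step: "\<exists>i\<ge>i0. ok j i" for i0 j
    unfolding ok_def by (rule ex) (simp_all add: F_def)
  have "\<exists>n. \<forall>j. ok j (n j) \<and> n j < n (Suc j)"
  proof (rule dependent_nat_choice)
    show "\<exists>i. ok 0 i" using step[of 0 0] by blast
    show "\<exists>i'. ok (Suc j) i' \<and> i < i'" for i j using step[of "Suc i" "Suc j"] by (auto simp: Suc_le_eq)
  qed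
  then obtain n where n: "\<And>j. ok j (n j)" "\<And>j. n j < n (Suc j)" by blast
  obtain \<Psi> where \<Psi>: "\<And>j. approximant D r (F j) (1 / (real j + 1)) (\<Phi> (n j)) (\<Psi> j)"
    using n(1) unfolding ok_def by metis
  have dir: "directed_set UNIV ((\<le>) :: nat \<Rightarrow> nat \<Rightarrow> bool)"
    unfolding directed_set_def by (blast intro: order_trans max.cobounded1 max.cobounded2)
  have e: "((\<lambda>j. 1 / (real j + 1)) \<longlongrightarrow> 0) (net_filter UNIV (\<le>))"
    using LIMSEQ_inverse_real_of_nat by (simp add: net_filter_nat inverse_eq_divide add.commute)
  have F: "eventually (\<lambda>j. t \<in> F j) (net_filter UNIV (\<le>))" for t
    unfolding net_filter_nat
  proof (rule eventually_sequentiallyI)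
    fix j assume "to_nat_on (UNIV :: 'a set) t \<le> j"
    moreover have "t = from_nat_into UNIV (to_nat_on UNIV t)" using count by simp
    ultimately show "t \<in> F j" unfolding F_def by blast
  qed
  note lim = approximants_limit[where \<Phi> = "\<lambda>j. \<Phi> (n j)", OF dir fin \<Psi> e F]
  show ?thesis
  proof (rule that[of n \<Psi>])
    show "strict_mono n" using n(2) by (simp add: strict_mono_Suc_iff)
    show "\<Psi> j \<subseteq> \<Phi> (n j)" for j using \<Psi>[of j] by (simp add: approximant_def)
  qed (use lim in auto)
qed

section \<open>Transfer from the limit mean back to finite sets\<close>

lemma sum_indicator_mult:
  assumes "finite X"
  shows "(\<Sum>x\<in>X. indicator S x * indicator C x) = real (card (S \<inter> (C \<inter> X)))"
proof -
  have "(\<Sum>x\<in>X. indicator S x * indicator C x :: real) = (\<Sum>x\<in>X. if x \<in> S \<inter> C then 1 else 0)"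
    by (intro sum.cong) (auto simp: indicator_def)
  also have "\<dots> = real (card (X \<inter> {x. x \<in> S \<inter> C}))" using assms by (simp add: sum.If_cases)
  also have "X \<inter> {x. x \<in> S \<inter> C} = S \<inter> (C \<inter> X)" by blast
  finally show ?thesis .
qed

text \<open>A point where the two sets differ lies in just one of \<open>X\<close> and its
  translate, or lies in both, and then membership in \<open>C\<close> changes between
  \<open>x\<close> and \<open>x - t\<close>.\<close>

lemma card_sym_diff_Int_le:
  fixes X C :: "'a::ab_group_add set"
  assumes X: "finite X"
  shows "real (card (sym_diff (C \<inter> X) ((\<lambda>x. x + t) ` (C \<inter> X))))
    \<le> (\<Sum>x\<in>X. \<bar>indicator C x - indicator C (x - t)\<bar>) + real (card (sym_diff X ((\<lambda>x. x + t) ` X)))"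
proof -
  have img: "x \<in> (\<lambda>x. x + t) ` Z \<longleftrightarrow> x - t \<in> Z" for x and Z :: "'a set"
    by (force simp: image_iff)
  let ?W = "X \<inter> {x. (x \<in> C) \<noteq> (x - t \<in> C)}"
  have "card (sym_diff (C \<inter> X) ((\<lambda>x. x + t) ` (C \<inter> X))) \<le> card (?W \<union> sym_diff X ((\<lambda>x. x + t) ` X))"
    using X by (intro card_mono) (auto simp: img)
  also have "\<dots> \<le> card ?W + card (sym_diff X ((\<lambda>x. x + t) ` X))" by (rule card_Un_le)
  finally have "real (card (sym_diff (C \<inter> X) ((\<lambda>x. x + t) ` (C \<inter> X))))
      \<le> real (card ?W) + real (card (sym_diff X ((\<lambda>x. x + t) ` X)))" by linarith
  moreover have "real (card ?W) = (\<Sum>x\<in>X. if (x \<in> C) \<noteq> (x - t \<in> C) then 1 else 0)"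
    using X by (simp add: sum.If_cases)
  moreover have "\<dots> = (\<Sum>x\<in>X. \<bar>indicator C x - indicator C (x - t)\<bar>)"
    by (intro sum.cong) (auto simp: indicator_def)
  ultimately show ?thesis by simp
qed

text \<open>The finitely many bounds satisfied by \<open>C\<close> concern limits along
  \<open>G\<close>, so some \<open>i\<close> above \<open>i0\<close> satisfies all of them with
  slack \<open>e\<close>, and \<open>Y\<close> is \<open>C \<inter> \<Phi> i\<close>. Errors
  relative to \<open>\<Phi> i\<close> become errors relative to \<open>Y\<close>, because
  \<open>Y\<close> fills at least the share \<open>\<delta> / 2\<close> of it.\<close>

lemma approximating_subset:
  fixes A B K :: "'a::{ab_group_add, discrete_topology} set" and \<Phi> :: "'i \<Rightarrow> 'a set"
  assumes K: "is_subgroup K" "finite_index K"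
    and ext: "\<And>\<nu> :: ('a \<Rightarrow>\<^sub>C real) \<Rightarrow>\<^sub>L real.
           \<nu> extreme_point_of invariant_means \<Longrightarrow>
           mean_of_set \<nu> (A + B) < mean_of_set \<nu> A + mean_of_set \<nu> B \<Longrightarrow>
           mean_of_set \<nu> (A + B) = mean_of_set \<nu> (A + B + K) \<and>
           mean_of_set \<nu> (A + B + K) =
             mean_of_set \<nu> (A + K) + mean_of_set \<nu> (B + K) - mean_of_set \<nu> K"
    and fol: "folner_net I le \<Phi>"
    and \<delta>: "\<delta> = lower_density I le \<Phi> A + lower_density I le \<Phi> B - lower_density I le \<Phi> (A + B)" "0 < \<delta>"
    and i0: "i0 \<in> I" and F: "finite F" and \<epsilon>: "0 < \<epsilon>"
  obtains i Y where "i \<in> I" "le i0 i" "approximant {} (real (group_index K) * \<delta>) F \<epsilon> (\<Phi> i) Y"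
    "(\<delta> - \<epsilon>) * real (card Y) \<le> real (card (A \<inter> Y)) + real (card (B \<inter> Y)) - real (card ((A + B) \<inter> Y))"
    "real (card ((A + B + K) \<inter> Y)) - real (card ((A + B) \<inter> Y)) \<le> \<epsilon> * real (card Y)"
proof -
  define k where "k = real (group_index K)"
  have k: "1 \<le> k"
  proof -
    have "cosets K \<noteq> {}" by (simp add: cosets_def)
    then have "0 < card (cosets K)" using K(2) by (simp add: finite_index_def card_gt_0_iff)
    then show ?thesis by (simp add: k_def group_index_def Suc_le_eq)
  qed
  \<comment> \<open>The first term secures the share \<open>\<delta> / 2\<close>, the second keeps
    the loss \<open>(k + 2) * e\<close> in the size of \<open>Y\<close> within
    \<open>\<epsilon>\<close>, and the third makes \<open>3 * e\<close> times the size of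
    \<open>\<Phi> i\<close> at most \<open>\<epsilon>\<close> times that of
    \<open>Y\<close>.\<close>
  define e where "e = Min {\<delta> / (2 * (k + 2)), \<epsilon> / (k + 2), \<epsilon> * \<delta> / 6}"
  have "0 < e" using \<delta>(2) \<epsilon> k by (simp add: e_def)
  have "e \<le> \<delta> / (2 * (k + 2))" "e \<le> \<epsilon> / (k + 2)" "e \<le> \<epsilon> * \<delta> / 6"
    unfolding e_def by (rule Min_le; simp)+
  then have ek: "(k + 2) * e \<le> \<delta> / 2" "(k + 2) * e \<le> \<epsilon>" "6 * e \<le> \<epsilon> * \<delta>"
    using k by (simp_all add: field_simps)
  have "3 * e \<le> (k + 2) * e" using k \<open>0 < e\<close> by (intro mult_right_mono) auto
  then have e3: "3 * e \<le> \<delta> / 2" "3 * e \<le> \<epsilon>" using ek by linarith+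
  have dir: "directed_set I le" and \<Phi>: "\<And>i. i \<in> I \<Longrightarrow> finite (\<Phi> i) \<and> \<Phi> i \<noteq> {}"
    using fol by (auto simp: folner_net_def)
  define den where "den S i = real (card (S \<inter> \<Phi> i)) / real (card (\<Phi> i))" for S i
  have den1: "\<bar>den S i\<bar> \<le> 1" if "i \<in> I" for S i
    using \<Phi>[OF that] card_mono[of "\<Phi> i" "S \<inter> \<Phi> i"] by (simp add: den_def divide_le_eq card_gt_0_iff)
  have low: "lower_density I le \<Phi> S = net_liminf I le (den S)" for S
    by (simp add: lower_density_def den_def[abs_def])
  \<comment> \<open>Along these indices the mean of \<open>A + B\<close> exceeds the lower density
    by at most \<open>e\<close>, which gives \<open>\<delta> - e \<le> \<mu> \<phi>\<close>.\<close>
  have "frequently (\<lambda>i. den (A + B) i < lower_density I le \<Phi> (A + B) + e) (net_filter I le)"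
    unfolding low using \<open>0 < e\<close> by (intro frequently_lt_net_liminf[OF dir den1]) auto
  from invariant_mean_limit[OF fol this] obtain m G where m: "m \<in> invariant_means" "G \<noteq> bot"
    "G \<le> net_filter I le" and evAB: "eventually (\<lambda>i. den (A + B) i < lower_density I le \<Phi> (A + B) + e) G"
    and limG: "\<And>f. ((\<lambda>i. average (\<Phi> i) (apply_bcontfun f)) \<longlongrightarrow> blinfun_apply m f) G"
    by blast
  have inI: "eventually (\<lambda>i. i \<in> I) G" using eventually_in_net[OF dir] m(3) by (rule filter_leD[rotated])
  define \<mu> where "\<mu> f = m (Bcontfun f)" for f
  have lim: "((\<lambda>i. average (\<Phi> i) f) \<longlongrightarrow> \<mu> f) G" if "bdd f" for f
    using limG[of "Bcontfun f"] that by (simp add: apply_Bcontfun \<mu>_def)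
  have limden: "(den S \<longlongrightarrow> \<mu> (indicator S)) G" for S
  proof (rule Lim_transform_eventually[OF lim])
    show "eventually (\<lambda>i. average (\<Phi> i) (indicator S) = den S i) G"
      using inI by eventually_elim (use \<Phi> in \<open>simp add: average_indicator den_def\<close>)
  qed (rule bdd_indicator)
  have \<mu>low: "lower_density I le \<Phi> S \<le> \<mu> (indicator S)" for S
  proof (rule field_le_epsilon)
    fix d :: real assume "0 < d"
    then have "eventually (\<lambda>i. lower_density I le \<Phi> S - d < den S i) (net_filter I le)"
      unfolding low by (intro eventually_gt_net_liminf[OF dir den1]) auto
    then have "eventually (\<lambda>i. lower_density I le \<Phi> S - d < den S i) G" using m(3) by (rule filter_leD[rotated])
    then have "eventually (\<lambda>i. lower_density I le \<Phi> S - d \<le> den S i) G" by (rule eventually_mono) simp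
    then have "lower_density I le \<Phi> S - d \<le> \<mu> (indicator S)"
      by (rule tendsto_lowerbound[OF limden _ m(2)])
    then show "lower_density I le \<Phi> S \<le> \<mu> (indicator S) + d" by simp
  qed
  have "eventually (\<lambda>i. den (A + B) i \<le> lower_density I le \<Phi> (A + B) + e) G"
    using evAB by (rule eventually_mono) simp
  then have \<mu>AB: "\<mu> (indicator (A + B)) \<le> lower_density I le \<Phi> (A + B) + e"
    by (rule tendsto_upperbound[OF limden _ m(2)])
  define \<phi> where "\<phi> = (\<lambda>x. indicator A x + indicator B x - indicator (A + B) x :: real)"
  define \<psi> where "\<psi> = (\<lambda>x. indicator (A + B + K) x - indicator (A + B) x :: real)"
  define \<theta> where "\<theta> = (\<lambda>x. indicator (A + K) x + indicator (B + K) x - indicator (A + B + K) x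
      - indicator K x :: real)"
  have b\<phi>: "bdd \<phi>" and b\<psi>: "bdd \<psi>" unfolding \<phi>_def \<psi>_def by (intro bdd_intros)+
  have bind: "bdd (indicator S :: 'a \<Rightarrow> real)" for S by (rule bdd_indicator)
  have m_pos: "m \<in> positive_invariant" using m(1) by (simp add: invariant_means_iff)
  have expand: "\<nu> (Bcontfun \<phi>) = mean_of_set \<nu> A + mean_of_set \<nu> B - mean_of_set \<nu> (A + B)"
    "\<nu> (Bcontfun \<psi>) = mean_of_set \<nu> (A + B + K) - mean_of_set \<nu> (A + B)"
    "\<nu> (Bcontfun \<theta>) = mean_of_set \<nu> (A + K) + mean_of_set \<nu> (B + K) - mean_of_set \<nu> (A + B + K)
      - mean_of_set \<nu> K" if "\<nu> \<in> positive_invariant" for \<nu>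
  proof -
    interpret \<nu>: invariant_functional "\<lambda>g. \<nu> (Bcontfun g)"
      by (rule invariant_functional_of_blinfun[OF that])
    show "\<nu> (Bcontfun \<phi>) = mean_of_set \<nu> A + mean_of_set \<nu> B - mean_of_set \<nu> (A + B)"
      "\<nu> (Bcontfun \<psi>) = mean_of_set \<nu> (A + B + K) - mean_of_set \<nu> (A + B)"
      "\<nu> (Bcontfun \<theta>) = mean_of_set \<nu> (A + K) + mean_of_set \<nu> (B + K) - mean_of_set \<nu> (A + B + K)
      - mean_of_set \<nu> K"
      unfolding \<phi>_def \<psi>_def \<theta>_def mean_of_set_def linf_indicator_def
      by (simp_all only: \<nu>.add \<nu>.diff bdd_intros bind)
  qed
  \<comment> \<open>Positivity at \<open>\<phi>\<close> is the strict inequality in the hypothesis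
    on extreme means; vanishing at \<open>\<psi>\<close> and \<open>\<theta>\<close> are its two
    conclusions.\<close>
  have extQ: "blinfun_apply \<nu> q = 0" if \<nu>: "\<nu> extreme_point_of invariant_means"
    and pos: "0 < blinfun_apply \<nu> (Bcontfun \<phi>)" and q: "q \<in> {Bcontfun \<psi>, Bcontfun \<theta>}" for \<nu> q
  proof -
    have \<nu>p: "\<nu> \<in> positive_invariant" using \<nu> by (simp add: extreme_point_of_def invariant_means_iff)
    show ?thesis using ext[OF \<nu>] pos q by (auto simp: expand[OF \<nu>p])
  qed
  obtain m1 where m1: "m1 \<in> positive_invariant" "m - m1 \<in> positive_invariant"
    "\<And>q. q \<in> {Bcontfun \<psi>, Bcontfun \<theta>} \<Longrightarrow> blinfun_apply m1 q = 0"
    "blinfun_apply m (Bcontfun \<phi>) \<le> blinfun_apply m1 (Bcontfun \<phi>)"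
    using invariant_mean_decomposition[OF extQ m(1)] by blast
  define \<mu>1 where "\<mu>1 f = m1 (Bcontfun f)" for f
  have "(indicator UNIV :: 'a \<Rightarrow> real) = (\<lambda>_. 1)" by (auto simp: indicator_def)
  then have one: "\<mu> (\<lambda>_. 1) = 1"
    using m(1) by (simp add: invariant_means_iff \<mu>_def linf_indicator_def)
  interpret dominated_functional \<mu> \<mu>1
  proof (intro dominated_functional.intro dominated_functional_axioms.intro)
    show "invariant_functional \<mu>" unfolding \<mu>_def by (rule invariant_functional_of_blinfun[OF m_pos])
    show "invariant_functional \<mu>1" unfolding \<mu>1_def by (rule invariant_functional_of_blinfun[OF m1(1)])
    show "\<mu>1 f \<le> \<mu> f" if "bdd f" "\<And>x. 0 \<le> f x" for f
    proof -
      have "0 \<le> blinfun_apply (m - m1) (Bcontfun f)"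
        using m1(2) that by (simp add: positive_invariant_def apply_Bcontfun)
      then show ?thesis by (simp add: \<mu>_def \<mu>1_def blinfun.diff_left)
    qed
  qed (rule one)
  have "\<mu> \<phi> = \<mu> (indicator A) + \<mu> (indicator B) - \<mu> (indicator (A + B))"
    using expand(1)[OF m_pos] by (simp add: \<mu>_def mean_of_set_def linf_indicator_def)
  then have "\<delta> - e \<le> \<mu> \<phi>" using \<mu>low[of A] \<mu>low[of B] \<mu>AB \<delta>(1) by linarith
  also have "\<mu> \<phi> \<le> \<mu>1 \<phi>" using m1(4) by (simp add: \<mu>_def \<mu>1_def)
  finally have \<mu>1\<phi>: "\<delta> - e \<le> \<mu>1 \<phi>" .
  have \<delta>e: "0 < \<delta> - e" using e3 \<delta>(2) \<open>0 < e\<close> by linarith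
  obtain C where C: "k * (\<delta> - e) - e \<le> \<mu> (indicator C)"
    "\<delta> - e - e \<le> \<mu> (\<lambda>x. \<phi> x * indicator C x)"
    "\<mu> (\<lambda>x. \<psi> x * indicator C x) \<le> e"
    "\<And>t. t \<in> F \<Longrightarrow> \<mu> (\<lambda>x. \<bar>indicator C x - indicator C (x - t)\<bar>) \<le> e"
    using realizing_set[of K A B "\<delta> - e" F e] K m1(3) \<delta>e \<mu>1\<phi> F \<open>0 < e\<close>
    unfolding \<phi>_def \<psi>_def \<theta>_def \<mu>1_def k_def by auto
  have ev1: "eventually (\<lambda>i. k * (\<delta> - e) - e - e < average (\<Phi> i) (indicator C)) G"
    using C(1) \<open>0 < e\<close> by (intro order_tendstoD(1)[OF lim] bind) linarith
  have ev2: "eventually (\<lambda>i. \<delta> - e - e - e < average (\<Phi> i) (\<lambda>x. \<phi> x * indicator C x)) G"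
    using C(2) \<open>0 < e\<close> by (intro order_tendstoD(1)[OF lim] bdd_intros b\<phi>) linarith
  have ev3: "eventually (\<lambda>i. average (\<Phi> i) (\<lambda>x. \<psi> x * indicator C x) < e + e) G"
    using C(3) \<open>0 < e\<close> by (intro order_tendstoD(2)[OF lim] bdd_intros b\<psi>) linarith
  have ev4: "eventually (\<lambda>i. \<forall>t\<in>F. average (\<Phi> i) (\<lambda>x. \<bar>indicator C x - indicator C (x - t)\<bar>) < e + e) G"
  proof (intro eventually_ball_finite F ballI)
    fix t assume "t \<in> F"
    then show "eventually (\<lambda>i. average (\<Phi> i) (\<lambda>x. \<bar>indicator C x - indicator C (x - t)\<bar>) < e + e) G"
      using C(4)[of t] \<open>0 < e\<close> by (intro order_tendstoD(2)[OF lim] bdd_intros) linarith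
  qed
  have ev5: "eventually (\<lambda>i. \<forall>t\<in>F. real (card (sym_diff (\<Phi> i) ((\<lambda>x. x + t) ` \<Phi> i))) / real (card (\<Phi> i)) < e) G"
  proof (intro eventually_ball_finite F ballI)
    fix t
    have "((\<lambda>i. real (card (sym_diff (\<Phi> i) ((\<lambda>x. x + t) ` \<Phi> i))) / real (card (\<Phi> i))) \<longlongrightarrow> 0) G"
      using fol unfolding folner_net_def by (intro tendsto_mono[OF m(3)]) blast
    then show "eventually (\<lambda>i. real (card (sym_diff (\<Phi> i) ((\<lambda>x. x + t) ` \<Phi> i))) / real (card (\<Phi> i)) < e) G"
      by (rule order_tendstoD(2)) (rule \<open>0 < e\<close>)
  qed
  have "eventually (le i0) G" using eventually_above[OF dir i0] m(3) by (rule filter_leD[rotated])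
  then have "eventually (\<lambda>i. i \<in> I \<and> le i0 i \<and>
      k * (\<delta> - e) - e - e < average (\<Phi> i) (indicator C) \<and>
      \<delta> - e - e - e < average (\<Phi> i) (\<lambda>x. \<phi> x * indicator C x) \<and>
      average (\<Phi> i) (\<lambda>x. \<psi> x * indicator C x) < e + e \<and>
      (\<forall>t\<in>F. average (\<Phi> i) (\<lambda>x. \<bar>indicator C x - indicator C (x - t)\<bar>) < e + e) \<and>
      (\<forall>t\<in>F. real (card (sym_diff (\<Phi> i) ((\<lambda>x. x + t) ` \<Phi> i))) / real (card (\<Phi> i)) < e)) G"
    using inI ev1 ev2 ev3 ev4 ev5 by (intro eventually_conj)
  from eventually_happens'[OF m(2) this] obtain i where i: "i \<in> I" "le i0 i"
    and avg: "k * (\<delta> - e) - e - e < average (\<Phi> i) (indicator C)"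
      "\<delta> - e - e - e < average (\<Phi> i) (\<lambda>x. \<phi> x * indicator C x)"
      "average (\<Phi> i) (\<lambda>x. \<psi> x * indicator C x) < e + e"
      "\<And>t. t \<in> F \<Longrightarrow> average (\<Phi> i) (\<lambda>x. \<bar>indicator C x - indicator C (x - t)\<bar>) < e + e"
      "\<And>t. t \<in> F \<Longrightarrow> real (card (sym_diff (\<Phi> i) ((\<lambda>x. x + t) ` \<Phi> i))) / real (card (\<Phi> i)) < e"
    by blast
  define X where "X = \<Phi> i"
  define Y where "Y = C \<inter> X"
  define N where "N = real (card X)"
  have X: "finite X" "0 < N" using \<Phi>[OF i(1)] by (simp_all add: X_def N_def card_gt_0_iff)
  have YX: "real (card Y) \<le> N" unfolding Y_def N_def using X(1) by (simp add: card_mono)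
  have Y1: "(k * (\<delta> - e) - e - e) * N \<le> real (card Y)"
    using avg(1) X by (simp add: average_indicator Y_def N_def X_def[symmetric] pos_less_divide_eq)
  have Y2: "(\<delta> - e - e - e) * N \<le> real (card (A \<inter> Y)) + real (card (B \<inter> Y)) - real (card ((A + B) \<inter> Y))"
  proof -
    have "(\<Sum>x\<in>X. \<phi> x * indicator C x)
        = real (card (A \<inter> Y)) + real (card (B \<inter> Y)) - real (card ((A + B) \<inter> Y))"
      by (simp add: \<phi>_def Y_def sum_indicator_mult[OF X(1), symmetric] sum.distrib sum_subtractf algebra_simps)
    then show ?thesis using avg(2) X(2) by (simp add: average_def X_def[symmetric] N_def[symmetric] pos_less_divide_eq)
  qed
  have Y3: "real (card ((A + B + K) \<inter> Y)) - real (card ((A + B) \<inter> Y)) \<le> (e + e) * N"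
  proof -
    have "(\<Sum>x\<in>X. \<psi> x * indicator C x) = real (card ((A + B + K) \<inter> Y)) - real (card ((A + B) \<inter> Y))"
      by (simp add: \<psi>_def Y_def sum_indicator_mult[OF X(1), symmetric] sum_subtractf left_diff_distrib)
    then show ?thesis using avg(3) X(2) by (simp add: average_def X_def[symmetric] N_def[symmetric] pos_divide_less_eq)
  qed
  have Y4: "real (card (sym_diff Y ((\<lambda>x. x + t) ` Y))) \<le> 3 * e * N" if "t \<in> F" for t
    using card_sym_diff_Int_le[OF X(1), of C t] avg(4,5)[OF that] X(2)
    by (simp add: average_def X_def[symmetric] N_def[symmetric] Y_def[symmetric] pos_divide_less_eq algebra_simps)
  have "k * (\<delta> - e) - e - e = k * \<delta> - (k + 2) * e" by (simp add: algebra_simps)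
  moreover have "1 * \<delta> \<le> k * \<delta>" using k \<delta>(2) by (intro mult_right_mono) auto
  ultimately have "\<delta> / 2 \<le> k * (\<delta> - e) - e - e" "k * \<delta> - \<epsilon> \<le> k * (\<delta> - e) - e - e"
    using ek by linarith+
  then have Y5: "\<delta> / 2 * N \<le> real (card Y)" "(k * \<delta> - \<epsilon>) * N \<le> real (card Y)"
    using Y1 X(2) by (meson less_imp_le mult_right_mono order_trans)+
  have small: "3 * e * N \<le> \<epsilon> * real (card Y)"
  proof -
    have "3 * e * N \<le> \<epsilon> * (\<delta> / 2) * N" using ek(3) X(2) by (intro mult_right_mono) auto
    also have "\<dots> = \<epsilon> * (\<delta> / 2 * N)" by simp
    also have "\<dots> \<le> \<epsilon> * real (card Y)" using Y5(1) \<epsilon> by (intro mult_left_mono) auto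
    finally show ?thesis .
  qed
  have "0 < \<delta> / 2 * N" using \<delta>(2) X(2) by simp
  then have "Y \<noteq> {}" using Y5(1) by auto
  show ?thesis
  proof (rule that[OF i])
    show "approximant {} (real (group_index K) * \<delta>) F \<epsilon> (\<Phi> i) Y"
      unfolding approximant_def k_def[symmetric] X_def[symmetric] N_def[symmetric]
      using \<open>Y \<noteq> {}\<close> Y5(2) order_trans[OF Y4 small] by (auto simp: Y_def)
    \<comment> \<open>As \<open>\<delta> - 3 * e\<close> is nonnegative and \<open>Y\<close> has at
      most \<open>N\<close> elements, the bound relative to \<open>\<Phi> i\<close> implies the one
      relative to \<open>Y\<close>.\<close>
    have "(\<delta> - \<epsilon>) * real (card Y) \<le> (\<delta> - e - e - e) * real (card Y)"
      using e3 by (intro mult_right_mono) auto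
    also have "\<dots> \<le> (\<delta> - e - e - e) * N" using YX e3 \<delta>(2) by (intro mult_left_mono) auto
    finally show "(\<delta> - \<epsilon>) * real (card Y) \<le> real (card (A \<inter> Y)) + real (card (B \<inter> Y)) - real (card ((A + B) \<inter> Y))"
      using Y2 by linarith
    have "(e + e) * N \<le> 3 * e * N" using X(2) \<open>0 < e\<close> by (intro mult_right_mono) auto
    then show "real (card ((A + B + K) \<inter> Y)) - real (card ((A + B) \<inter> Y)) \<le> \<epsilon> * real (card Y)"
      using Y3 small by linarith
  qed
qed



text \<open>The ratios of the available subsets vary, while \<open>approximant\<close> needs fixed
  numbers. They come from a cluster point of the ratios in the unit cube along the directed set of
  all demands: beyond every demand there is a stronger one with ratios close to that point.
  \<open>S3\<close> and \<open>S4\<close> share \<open>c\<close>, as their ratios differ by at most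
  the tolerance.\<close>

lemma approximants_exist:
  fixes S1 S2 S3 S4 :: "'a::ab_group_add set" and \<Phi> :: "'i \<Rightarrow> 'a set"
  assumes dir: "directed_set I le" and fin: "\<And>i. i \<in> I \<Longrightarrow> finite (\<Phi> i)"
    and sub: "S3 \<subseteq> S4"
    and ex: "\<And>i0 F \<epsilon>. i0 \<in> I \<Longrightarrow> finite F \<Longrightarrow> 0 < \<epsilon> \<Longrightarrow>
      \<exists>i Y. i \<in> I \<and> le i0 i \<and> approximant {} r F \<epsilon> (\<Phi> i) Y \<and>
        (\<delta> - \<epsilon>) * real (card Y) \<le> real (card (S1 \<inter> Y)) + real (card (S2 \<inter> Y)) - real (card (S3 \<inter> Y)) \<and>
        real (card (S4 \<inter> Y)) - real (card (S3 \<inter> Y)) \<le> \<epsilon> * real (card Y)"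
  obtains a b c where "\<delta> \<le> a + b - c"
    "\<And>i0 F \<epsilon>. i0 \<in> I \<Longrightarrow> finite F \<Longrightarrow> 0 < \<epsilon> \<Longrightarrow>
      \<exists>i\<in>I. le i0 i \<and> (\<exists>Y. approximant {(S1, a), (S2, b), (S3, c), (S4, c)} r F \<epsilon> (\<Phi> i) Y)"
proof -
  define T where "T = {(i, F :: 'a set, n :: nat). i \<in> I \<and> finite F}"
  define leT where "leT = (\<lambda>(i, F :: 'a set, n :: nat) (j, G, m). le i j \<and> F \<subseteq> G \<and> n \<le> m)"
  have trans: "le i k" if "i \<in> I" "j \<in> I" "k \<in> I" "le i j" "le j k" for i j k
    using dir that unfolding directed_set_def by blast
  have dirT: "directed_set T leT" unfolding directed_set_def
  proof (intro conjI ballI impI)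
    obtain i0 where "i0 \<in> I" using dir unfolding directed_set_def by blast
    then have "(i0, {}, 0) \<in> T" by (simp add: T_def)
    then show "T \<noteq> {}" by blast
    show "leT x z" if "x \<in> T" "y \<in> T" "z \<in> T" "leT x y" "leT y z" for x y z
    proof -
      have "fst x \<in> I" "fst y \<in> I" "fst z \<in> I" "le (fst x) (fst y)" "le (fst y) (fst z)"
        using that by (auto simp: T_def leT_def)
      then have "le (fst x) (fst z)" by (rule trans)
      then show ?thesis using that(4,5) by (auto simp: leT_def split: prod.splits)
    qed
    fix x y assume xy: "x \<in> T" "y \<in> T"
    obtain i F n where x: "x = (i, F, n)" by (cases x)
    obtain j G m where y: "y = (j, G, m)" by (cases y)
    have "i \<in> I" "j \<in> I" using xy by (simp_all add: x y T_def)
    then obtain k where "k \<in> I" "le i k" "le j k" using dir unfolding directed_set_def by blast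
    then show "\<exists>z\<in>T. leT x z \<and> leT y z"
      using xy by (intro bexI[of _ "(k, F \<union> G, max n m)"]) (simp_all add: T_def leT_def x y)
  qed
  define good where "good t i Y \<longleftrightarrow> i \<in> I \<and> le (fst t) i \<and>
      approximant {} r (fst (snd t)) (1 / (real (snd (snd t)) + 1)) (\<Phi> i) Y \<and>
      (\<delta> - 1 / (real (snd (snd t)) + 1)) * real (card Y)
        \<le> real (card (S1 \<inter> Y)) + real (card (S2 \<inter> Y)) - real (card (S3 \<inter> Y)) \<and>
      real (card (S4 \<inter> Y)) - real (card (S3 \<inter> Y)) \<le> 1 / (real (snd (snd t)) + 1) * real (card Y)"
    for t :: "'i \<times> 'a set \<times> nat" and i Y
  have "\<exists>z. good t (fst z) (snd z)" if t: "t \<in> T" for t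
  proof -
    have "fst t \<in> I" "finite (fst (snd t))" "(0::real) < 1 / (real (snd (snd t)) + 1)"
      using t by (auto simp: T_def)
    from ex[OF this] obtain i Y where "good t i Y" unfolding good_def by blast
    then show ?thesis by (intro exI[of _ "(i, Y)"]) simp
  qed
  then obtain w where w: "\<And>t. t \<in> T \<Longrightarrow> good t (fst (w t)) (snd (w t))" by metis
  define ratio where "ratio S t = real (card (S \<inter> snd (w t))) / real (card (snd (w t)))" for S t
  define v where "v t = (ratio S1 t, ratio S2 t, ratio S3 t)" for t
  have Y: "snd (w t) \<subseteq> \<Phi> (fst (w t))" "finite (snd (w t))" "0 < real (card (snd (w t)))" if "t \<in> T" for t
  proof -
    have i: "fst (w t) \<in> I" and a: "approximant {} r (fst (snd t)) (1 / (real (snd (snd t)) + 1)) (\<Phi> (fst (w t))) (snd (w t))"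
      using w[OF that] by (simp_all add: good_def)
    show sub: "snd (w t) \<subseteq> \<Phi> (fst (w t))" using a by (simp add: approximant_def)
    show f: "finite (snd (w t))" by (rule finite_subset[OF sub fin[OF i]])
    show "0 < real (card (snd (w t)))" using a f by (simp add: approximant_def card_gt_0_iff)
  qed
  have ratio01: "ratio S t \<in> {0..1}" if "t \<in> T" for S t
    using Y(2,3)[OF that] card_mono[of "snd (w t)" "S \<inter> snd (w t)"] by (simp add: ratio_def divide_le_eq)
  have "filtermap v (net_filter T leT) \<noteq> bot"
    using net_filter_neq_bot[OF dirT] by (simp add: filtermap_bot_iff)
  moreover have "eventually (\<lambda>t. v t \<in> {0..1} \<times> {0..1} \<times> {0..1}) (net_filter T leT)"
    using eventually_in_net[OF dirT] by eventually_elim (simp only: v_def mem_Times_iff fst_conv snd_conv ratio01)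
  then have "eventually (\<lambda>p. p \<in> {0..1} \<times> {0..1} \<times> {0..1}) (filtermap v (net_filter T leT))"
    by (simp only: eventually_filtermap)
  moreover have "compact ({0..1} \<times> {0..1} \<times> {0..1} :: (real \<times> real \<times> real) set)"
    by (intro compact_Times compact_Icc)
  ultimately obtain p where p: "inf (nhds p) (filtermap v (net_filter T leT)) \<noteq> bot"
    unfolding compact_filter by blast
  obtain a b c where abc: "p = (a, b, c)" by (cases p)
  have cluster: "\<exists>t\<in>T. leT s t \<and> \<bar>ratio S1 t - a\<bar> < e \<and> \<bar>ratio S2 t - b\<bar> < e \<and> \<bar>ratio S3 t - c\<bar> < e"
    if s: "s \<in> T" and e: "0 < e" for s e
  proof (rule ccontr)
    assume no: "\<not> ?thesis"
    have "eventually (\<lambda>t. t \<in> T \<and> leT s t) (net_filter T leT)"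
      by (intro eventually_conj eventually_in_net[OF dirT] eventually_above[OF dirT s])
    then have "eventually (\<lambda>t. v t \<notin> ball p e) (net_filter T leT)"
    proof eventually_elim
      case (elim t)
      have "\<bar>ratio S1 t - a\<bar> < e \<and> \<bar>ratio S2 t - b\<bar> < e \<and> \<bar>ratio S3 t - c\<bar> < e" if "v t \<in> ball p e"
      proof -
        have d: "dist (v t) p < e" using that by (simp add: dist_commute)
        have "dist (ratio S1 t) a \<le> dist (v t) p" "dist (snd (v t)) (snd p) \<le> dist (v t) p"
          using dist_fst_le[of "v t" p] dist_snd_le[of "v t" p] by (simp_all add: v_def abc)
        moreover have "dist (ratio S2 t) b \<le> dist (snd (v t)) (snd p)" "dist (ratio S3 t) c \<le> dist (snd (v t)) (snd p)"
          using dist_fst_le[of "snd (v t)" "snd p"] dist_snd_le[of "snd (v t)" "snd p"] by (simp_all add: v_def abc)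
        ultimately show ?thesis using d by (simp add: dist_real_def)
      qed
      then show ?case using no elim by blast
    qed
    then have "eventually (\<lambda>q. q \<notin> ball p e) (filtermap v (net_filter T leT))"
      by (simp only: eventually_filtermap)
    moreover have "eventually (\<lambda>q. q \<in> ball p e) (nhds p)"
      by (rule eventually_nhds_in_open) (use e in auto)
    ultimately have "eventually (\<lambda>_. False) (inf (nhds p) (filtermap v (net_filter T leT)))"
      unfolding eventually_inf by blast
    then show False using p unfolding trivial_limit_def by contradiction
  qed
  have close: "\<exists>t\<in>T. leT (i0, F, 0) t \<and> 1 / (real (snd (snd t)) + 1) \<le> \<epsilon> \<and>
      \<bar>ratio S1 t - a\<bar> < \<epsilon> \<and> \<bar>ratio S2 t - b\<bar> < \<epsilon> \<and> \<bar>ratio S3 t - c\<bar> < \<epsilon>"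
    if i0: "i0 \<in> I" and F: "finite F" and \<epsilon>: "0 < \<epsilon>" for i0 F \<epsilon>
  proof -
    obtain n :: nat where n: "1 / \<epsilon> < real n" using reals_Archimedean2 by blast
    have "(i0, F, n) \<in> T" using i0 F by (simp add: T_def)
    from cluster[OF this \<epsilon>] obtain t where t: "t \<in> T" "leT (i0, F, n) t"
      "\<bar>ratio S1 t - a\<bar> < \<epsilon>" "\<bar>ratio S2 t - b\<bar> < \<epsilon>" "\<bar>ratio S3 t - c\<bar> < \<epsilon>" by blast
    have le: "le i0 (fst t)" "F \<subseteq> fst (snd t)" "n \<le> snd (snd t)"
      using t(2) by (auto simp: leT_def split: prod.splits)
    have "1 / \<epsilon> < real (snd (snd t)) + 1" using n le(3) by linarith
    then have "1 / (real (snd (snd t)) + 1) \<le> \<epsilon>" using \<epsilon> by (simp add: field_simps)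
    moreover have "leT (i0, F, 0) t" using le by (auto simp: leT_def split: prod.splits)
    ultimately show ?thesis using t by blast
  qed
  have ratio_bounds: "\<delta> - 1 / (real (snd (snd t)) + 1) \<le> ratio S1 t + ratio S2 t - ratio S3 t"
    "ratio S3 t \<le> ratio S4 t" "ratio S4 t - ratio S3 t \<le> 1 / (real (snd (snd t)) + 1)" if t: "t \<in> T" for t
  proof -
    have "card (S3 \<inter> snd (w t)) \<le> card (S4 \<inter> snd (w t))"
      using sub Y(2)[OF t] by (intro card_mono) auto
    then show "ratio S3 t \<le> ratio S4 t" by (simp add: ratio_def divide_right_mono)
    show "\<delta> - 1 / (real (snd (snd t)) + 1) \<le> ratio S1 t + ratio S2 t - ratio S3 t"
      "ratio S4 t - ratio S3 t \<le> 1 / (real (snd (snd t)) + 1)"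
      using w[OF t] unfolding good_def ratio_def add_divide_distrib[symmetric] diff_divide_distrib[symmetric]
      by (simp_all only: pos_le_divide_eq[OF Y(3)[OF t]] pos_divide_le_eq[OF Y(3)[OF t]])
  qed
  show ?thesis
  proof (rule that[of a b c])
    obtain i0 where i0: "i0 \<in> I" using dir unfolding directed_set_def by blast
    show "\<delta> \<le> a + b - c"
    proof (rule field_le_epsilon)
      fix e :: real assume "0 < e"
      \<comment> \<open>Four errors occur: those of three ratios, and the tolerance of the demand
        \<open>t\<close>.\<close>
      then have "0 < e / 4" by simp
      from close[OF i0 finite.emptyI this] obtain t where t: "t \<in> T" "1 / (real (snd (snd t)) + 1) \<le> e / 4"
        "\<bar>ratio S1 t - a\<bar> < e / 4" "\<bar>ratio S2 t - b\<bar> < e / 4" "\<bar>ratio S3 t - c\<bar> < e / 4" by blast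
      show "\<delta> \<le> a + b - c + e" using t(2-) ratio_bounds(1)[OF t(1)] by linarith
    qed
    fix i0 and F :: "'a set" and \<epsilon> :: real assume i0: "i0 \<in> I" and F: "finite F" and \<epsilon>: "0 < \<epsilon>"
    \<comment> \<open>The ratio of \<open>S4\<close> is compared with \<open>c\<close> through that
      of \<open>S3\<close>, at the cost of two errors.\<close>
    then have "0 < \<epsilon> / 2" by simp
    from close[OF i0 F this] obtain t where t: "t \<in> T" "leT (i0, F, 0) t" "1 / (real (snd (snd t)) + 1) \<le> \<epsilon> / 2"
      "\<bar>ratio S1 t - a\<bar> < \<epsilon> / 2" "\<bar>ratio S2 t - b\<bar> < \<epsilon> / 2" "\<bar>ratio S3 t - c\<bar> < \<epsilon> / 2" by blast
    have g: "fst (w t) \<in> I" "le (fst t) (fst (w t))"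
      "approximant {} r (fst (snd t)) (1 / (real (snd (snd t)) + 1)) (\<Phi> (fst (w t))) (snd (w t))"
      using w[OF t(1)] by (simp_all add: good_def)
    have le: "le i0 (fst t)" "F \<subseteq> fst (snd t)" "fst t \<in> I"
      using t(1,2) by (auto simp: leT_def T_def split: prod.splits)
    have "approximant {} r F \<epsilon> (\<Phi> (fst (w t))) (snd (w t))"
      using t(3) \<epsilon> by (intro approximant_mono[OF g(3) le(2)]) linarith
    moreover have "\<bar>ratio S1 t - a\<bar> \<le> \<epsilon>" "\<bar>ratio S2 t - b\<bar> \<le> \<epsilon>" "\<bar>ratio S3 t - c\<bar> \<le> \<epsilon>" "\<bar>ratio S4 t - c\<bar> \<le> \<epsilon>"
      using t(3-6) ratio_bounds(2,3)[OF t(1)] \<epsilon> by linarith+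
    ultimately have "approximant {(S1, a), (S2, b), (S3, c), (S4, c)} r F \<epsilon> (\<Phi> (fst (w t))) (snd (w t))"
      unfolding approximant_def ratio_def by simp
    moreover have "le i0 (fst (w t))" by (rule trans[OF i0 le(3) g(1) le(1) g(2)])
    ultimately show "\<exists>i\<in>I. le i0 i \<and>
        (\<exists>Y. approximant {(S1, a), (S2, b), (S3, c), (S4, c)} r F \<epsilon> (\<Phi> i) Y)"
      using g(1) by blast
  qed
qed

theorem theorem3p6:
  fixes A B K :: "'a::{ab_group_add, discrete_topology} set"
  assumes "A \<noteq> {}" and "B \<noteq> {}"
    and "is_subgroup K" and "finite_index K"
    and "stabilizer (A + B + K) = K"
    and "\<And>\<nu> :: ('a \<Rightarrow>\<^sub>C real) \<Rightarrow>\<^sub>L real.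
           \<nu> extreme_point_of invariant_means \<Longrightarrow>
           mean_of_set \<nu> (A + B) < mean_of_set \<nu> A + mean_of_set \<nu> B \<Longrightarrow>
           mean_of_set \<nu> (A + B) = mean_of_set \<nu> (A + B + K) \<and>
           mean_of_set \<nu> (A + B + K) =
             mean_of_set \<nu> (A + K) + mean_of_set \<nu> (B + K) - mean_of_set \<nu> K"
  shows "(\<forall>(I :: 'i set) le \<Phi> \<delta>.
            folner_net I le \<Phi> \<longrightarrow>
            \<delta> = lower_density I le \<Phi> A + lower_density I le \<Phi> B - lower_density I le \<Phi> (A + B) \<longrightarrow>
            \<delta> > 0 \<longrightarrow>
            (\<exists>(J :: ('i \<times> 'a set \<times> nat) set) le' h \<Psi> a b c.
               subnet_map I le J le' h \<and> folner_net J le' \<Psi> \<and>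
               (\<forall>j\<in>J. \<Psi> j \<subseteq> \<Phi> (h j)) \<and>
               net_liminf J le' (\<lambda>j. real (card (\<Psi> j)) / real (card (\<Phi> (h j))))
                 \<ge> real (group_index K) * \<delta> \<and>
               has_density J le' \<Psi> A a \<and> has_density J le' \<Psi> B b \<and>
               has_density J le' \<Psi> (A + B) c \<and> has_density J le' \<Psi> (A + B + K) c \<and>
               a + b - c \<ge> \<delta>)) \<and>
         (\<forall>(\<Phi> :: nat \<Rightarrow> 'a set) \<delta>.
            folner_sequence \<Phi> \<longrightarrow>
            \<delta> = lower_density UNIV (\<le>) \<Phi> A + lower_density UNIV (\<le>) \<Phi> B
                  - lower_density UNIV (\<le>) \<Phi> (A + B) \<longrightarrow>
            \<delta> > 0 \<longrightarrow>
            (\<exists>(n :: nat \<Rightarrow> nat) \<Psi> a b c.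
               strict_mono n \<and> folner_sequence \<Psi> \<and>
               (\<forall>j. \<Psi> j \<subseteq> \<Phi> (n j)) \<and>
               net_liminf UNIV (\<le>) (\<lambda>j. real (card (\<Psi> j)) / real (card (\<Phi> (n j))))
                 \<ge> real (group_index K) * \<delta> \<and>
               has_density UNIV (\<le>) \<Psi> A a \<and> has_density UNIV (\<le>) \<Psi> B b \<and>
               has_density UNIV (\<le>) \<Psi> (A + B) c \<and> has_density UNIV (\<le>) \<Psi> (A + B + K) c \<and>
               a + b - c \<ge> \<delta>))"
proof -
  have "0 \<in> K" using assms(3) by (simp add: is_subgroup_def)
  then have sub: "A + B \<subseteq> A + B + K" using set_plus_intro[of _ "A + B" 0 K] by auto
  \<comment> \<open>The index type is left arbitrary, so that nets on \<open>'i\<close> and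
    sequences are both instances.\<close>
  have approximants: thesis
    if fol: "folner_net I le \<Phi>"
      and \<delta>: "\<delta> = lower_density I le \<Phi> A + lower_density I le \<Phi> B - lower_density I le \<Phi> (A + B)" "\<delta> > 0"
      and *: "\<And>a b c. \<delta> \<le> a + b - c \<Longrightarrow>
        (\<And>i0 F \<epsilon>. i0 \<in> I \<Longrightarrow> finite F \<Longrightarrow> 0 < \<epsilon> \<Longrightarrow> \<exists>i\<in>I. le i0 i \<and>
          (\<exists>Y. approximant {(A, a), (B, b), (A + B, c), (A + B + K, c)} (real (group_index K) * \<delta>) F \<epsilon> (\<Phi> i) Y))
        \<Longrightarrow> thesis"
    for I :: "'k set" and le \<Phi> \<delta> thesis
  proof (rule approximants_exist)
    show "directed_set I le" "\<And>i. i \<in> I \<Longrightarrow> finite (\<Phi> i)" using fol by (auto simp: folner_net_def)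
    fix i0 :: 'k and F :: "'a set" and \<epsilon> :: real assume "i0 \<in> I" "finite F" "0 < \<epsilon>"
    from approximating_subset[OF assms(3,4,6) fol \<delta> this]
    show "\<exists>i Y. i \<in> I \<and> le i0 i \<and> approximant {} (real (group_index K) * \<delta>) F \<epsilon> (\<Phi> i) Y \<and>
        (\<delta> - \<epsilon>) * real (card Y) \<le> real (card (A \<inter> Y)) + real (card (B \<inter> Y)) - real (card ((A + B) \<inter> Y)) \<and>
        real (card ((A + B + K) \<inter> Y)) - real (card ((A + B) \<inter> Y)) \<le> \<epsilon> * real (card Y)"
      by metis
  qed (rule sub, rule *, assumption, blast)
  show ?thesis
  proof (intro conjI allI impI)
    fix I :: "'i set" and le \<Phi> and \<delta> :: real
    assume fol: "folner_net I le \<Phi>"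
      and \<delta>: "\<delta> = lower_density I le \<Phi> A + lower_density I le \<Phi> B - lower_density I le \<Phi> (A + B)" "\<delta> > 0"
    have dir: "directed_set I le" and fin: "\<And>i. i \<in> I \<Longrightarrow> finite (\<Phi> i)"
      using fol by (auto simp: folner_net_def)
    obtain a b c where abc: "\<delta> \<le> a + b - c" and ex: "\<And>i0 F \<epsilon>. i0 \<in> I \<Longrightarrow> finite F \<Longrightarrow> 0 < \<epsilon> \<Longrightarrow>
        \<exists>i\<in>I. le i0 i \<and> (\<exists>Y. approximant {(A, a), (B, b), (A + B, c), (A + B + K, c)}
          (real (group_index K) * \<delta>) F \<epsilon> (\<Phi> i) Y)"
      by (rule approximants[OF fol \<delta>]) (rule that, assumption, blast)
    obtain J :: "('i \<times> 'a set \<times> nat) set" and le' h \<Psi> where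
      "subnet_map I le J le' h" "folner_net J le' \<Psi>" "\<And>j. j \<in> J \<Longrightarrow> \<Psi> j \<subseteq> \<Phi> (h j)"
      "real (group_index K) * \<delta> \<le> net_liminf J le' (\<lambda>j. real (card (\<Psi> j)) / real (card (\<Phi> (h j))))"
      "\<And>S d. (S, d) \<in> {(A, a), (B, b), (A + B, c), (A + B + K, c)} \<Longrightarrow> has_density J le' \<Psi> S d"
      by (rule subnet_from_approximants[OF dir fin ex]) (assumption | rule that | blast)+
    with abc show "\<exists>(J :: ('i \<times> 'a set \<times> nat) set) le' h \<Psi> a b c.
               subnet_map I le J le' h \<and> folner_net J le' \<Psi> \<and>
               (\<forall>j\<in>J. \<Psi> j \<subseteq> \<Phi> (h j)) \<and>
               net_liminf J le' (\<lambda>j. real (card (\<Psi> j)) / real (card (\<Phi> (h j))))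
                 \<ge> real (group_index K) * \<delta> \<and>
               has_density J le' \<Psi> A a \<and> has_density J le' \<Psi> B b \<and>
               has_density J le' \<Psi> (A + B) c \<and> has_density J le' \<Psi> (A + B + K) c \<and>
               a + b - c \<ge> \<delta>"
      by (intro exI[of _ J] exI[of _ le'] exI[of _ h] exI[of _ \<Psi>] exI[of _ a] exI[of _ b] exI[of _ c])
        simp
  next
    fix \<Phi> :: "nat \<Rightarrow> 'a set" and \<delta> :: real
    assume fol: "folner_sequence \<Phi>"
      and \<delta>: "\<delta> = lower_density UNIV (\<le>) \<Phi> A + lower_density UNIV (\<le>) \<Phi> B
                  - lower_density UNIV (\<le>) \<Phi> (A + B)" "\<delta> > 0"
    have fin: "\<And>i. finite (\<Phi> i)" using fol by (auto simp: folner_net_def)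
    obtain a b c where abc: "\<delta> \<le> a + b - c" and ex: "\<And>i0 F \<epsilon>. i0 \<in> UNIV \<Longrightarrow> finite F \<Longrightarrow> 0 < \<epsilon> \<Longrightarrow>
        \<exists>i\<in>UNIV. i0 \<le> i \<and> (\<exists>Y. approximant {(A, a), (B, b), (A + B, c), (A + B + K, c)}
          (real (group_index K) * \<delta>) F \<epsilon> (\<Phi> i) Y)"
      by (rule approximants[OF fol \<delta>]) (rule that, assumption, blast)
    have ex': "\<exists>i\<ge>i0. \<exists>Y. approximant {(A, a), (B, b), (A + B, c), (A + B + K, c)}
        (real (group_index K) * \<delta>) F \<epsilon> (\<Phi> i) Y" if "finite F" "0 < \<epsilon>" for i0 F \<epsilon>
      using ex[OF UNIV_I that] by blast
    obtain n :: "nat \<Rightarrow> nat" and \<Psi> where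
      "strict_mono n" "folner_sequence \<Psi>" "\<And>j. \<Psi> j \<subseteq> \<Phi> (n j)"
      "real (group_index K) * \<delta> \<le> net_liminf UNIV (\<le>) (\<lambda>j. real (card (\<Psi> j)) / real (card (\<Phi> (n j))))"
      "\<And>S d. (S, d) \<in> {(A, a), (B, b), (A + B, c), (A + B + K, c)} \<Longrightarrow> has_density UNIV (\<le>) \<Psi> S d"
      by (rule subsequence_from_approximants[OF folner_sequence_countable[OF fol] fin ex']) (assumption | rule that | blast)+
    with abc show "\<exists>(n :: nat \<Rightarrow> nat) \<Psi> a b c.
               strict_mono n \<and> folner_sequence \<Psi> \<and>
               (\<forall>j. \<Psi> j \<subseteq> \<Phi> (n j)) \<and>
               net_liminf UNIV (\<le>) (\<lambda>j. real (card (\<Psi> j)) / real (card (\<Phi> (n j))))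
                 \<ge> real (group_index K) * \<delta> \<and>
               has_density UNIV (\<le>) \<Psi> A a \<and> has_density UNIV (\<le>) \<Psi> B b \<and>
               has_density UNIV (\<le>) \<Psi> (A + B) c \<and> has_density UNIV (\<le>) \<Psi> (A + B + K) c \<and>
               a + b - c \<ge> \<delta>"
      by (intro exI[of _ n] exI[of _ \<Psi>] exI[of _ a] exI[of _ b] exI[of _ c]) simp
  qed
qed

end
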